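(* Let $K$ be a non-empty polytope given as $K = \{ x \in \mathbb{R}^n : g_1(x) \ge 0,\ldots, g_s(x) \ge 0\}$, where $g_1,\ldots,g_s \in \mathbb{R}[x]=\mathbb{R}[x_1,\ldots,x_n]$ are polynomials of degree one, and let $g = (g_1,\ldots,g_s)$. Then, for every finite set $A \subseteq \mathbb{N}^n \setminus \{0\}$, one has $$\mathcal{M}_A(K) = \left\{ v \in \mathbb{R}^{\mathbb{N}^n} : v_0 = 1, \ L_v(g^\beta) \ge 0 \ \text{for all} \ \beta \in \mathbb{N}^s\right\}_A .$$
   Context: $\mathbb{N}$ contains $0$. For $\alpha \in \mathbb{N}^n$, $x^\alpha = x_1^{\alpha_1}\cdots x_n^{\alpha_n}$; for $\beta \in \mathbb{N}^s$, $g^\beta = g_1^{\beta_1}\cdots g_s^{\beta_s}$. A polytope is a bounded polyhedron. For a finite $A \subseteq \mathbb{N}^n$, the moment body is $\mathcal{M}_A(K) := \operatorname{conv}\{ (x^\alpha)_{\alpha \in A} : x \in K\} \subseteq \mathbb{R}^A$. For $v=(v_\alpha)$ the linearization $L_v$ is the linear map with $L_v(\sum_\alpha f_\alpha x^\alpha) = \sum_\alpha f_\alpha v_\alpha$. For $Y \subseteq \mathbb{R}^{\mathbb{N}^n}$, $Y_A = \{ (y_\alpha)_{\alpha \in A} : y \in Y\}$ is the projection of $Y$ onto the coordinates indexed by $A$. *)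

theory Defs
  imports "HOL-Analysis.Analysis" "HOL-Analysis.Finite_Function_Topology"
begin

text \<open>
  With the variables indexed by a finite type \<open>'n\<close>, the multi-indices in \<open>\<nat>\<^sup>n\<close> are the elements of
  \<^typ>\<open>'n \<Rightarrow>\<^sub>0 nat\<close>, and the polynomial ring \<open>\<real>[x\<^sub>1, \<dots>, x\<^sub>n]\<close> is the monoid algebra \<open>'n mpoly\<close> below:
  a polynomial is its coefficient function, and the multiplication of \<^type>\<open>poly_mapping\<close> is
  convolution.
\<close>

type_synonym 'n mpoly = "('n \<Rightarrow>\<^sub>0 nat) \<Rightarrow>\<^sub>0 real"

definition monomial_at :: "('n::finite \<Rightarrow>\<^sub>0 nat) \<Rightarrow> real^'n \<Rightarrow> real" where
  "monomial_at \<alpha> x = (\<Prod>i\<in>UNIV. (x $ i) ^ Poly_Mapping.lookup \<alpha> i)"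

definition mpoly_at :: "('n::finite) mpoly \<Rightarrow> real^'n \<Rightarrow> real" where
  "mpoly_at f x = (\<Sum>\<alpha>\<in>Poly_Mapping.keys f. Poly_Mapping.lookup f \<alpha> * monomial_at \<alpha> x)"

text \<open>The zero polynomial is given total degree 0.\<close>

definition total_degree :: "('n::finite) mpoly \<Rightarrow> nat" where
  "total_degree f =
     Max (insert 0 ((\<lambda>\<alpha>. \<Sum>i\<in>UNIV. Poly_Mapping.lookup \<alpha> i) ` Poly_Mapping.keys f))"

text \<open>Only the entries of \<open>\<beta>\<close> below \<open>s\<close> matter, so \<open>\<beta>\<close> stands for an element of \<open>\<nat>\<^sup>s\<close>.\<close>

definition power_product :: "nat \<Rightarrow> (nat \<Rightarrow> 'a::comm_monoid_mult) \<Rightarrow> (nat \<Rightarrow> nat) \<Rightarrow> 'a" where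
  "power_product s g \<beta> = (\<Prod>i<s. g i ^ \<beta> i)"

definition linearization :: "(('n::finite \<Rightarrow>\<^sub>0 nat) \<Rightarrow> real) \<Rightarrow> 'n mpoly \<Rightarrow> real" where
  "linearization v f = (\<Sum>\<alpha>\<in>Poly_Mapping.keys f. Poly_Mapping.lookup f \<alpha> * v \<alpha>)"

text \<open>
  For finite \<open>A\<close>, the space \<open>\<real>\<^sup>A\<close> is represented by the finitely supported families vanishing outside
  \<open>A\<close>; \<open>coord_proj A v\<close> is then the family \<open>(v\<^sub>\<alpha>)\<close> with \<open>\<alpha>\<close> in \<open>A\<close>, written in the standard basis.
\<close>

definition coord_proj :: "'a set \<Rightarrow> ('a \<Rightarrow> real) \<Rightarrow> ('a \<Rightarrow>\<^sub>0 real)" where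
  "coord_proj A v = (\<Sum>\<alpha>\<in>A. Poly_Mapping.single \<alpha> (v \<alpha>))"

definition moment_body ::
    "('n::finite \<Rightarrow>\<^sub>0 nat) set \<Rightarrow> (real^'n) set \<Rightarrow> (('n \<Rightarrow>\<^sub>0 nat) \<Rightarrow>\<^sub>0 real) set" where
  "moment_body A K = convex hull ((\<lambda>x. coord_proj A (\<lambda>\<alpha>. monomial_at \<alpha> x)) ` K)"

lemma lookup_coord_proj:
  assumes "finite A"
  shows "Poly_Mapping.lookup (coord_proj A v) \<alpha> = (if \<alpha> \<in> A then v \<alpha> else 0)"
  using assms by (simp add: coord_proj_def lookup_sum lookup_single when_def)

lemma linearization_single: "linearization v (Poly_Mapping.single \<alpha> c) = c * v \<alpha>"
  by (simp add: linearization_def)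

lemma linearization_add: "linearization v (f + h) = linearization v f + linearization v h"
  unfolding linearization_def
  by (rule setsum_keys_plus_distrib) (simp_all add: distrib_right)

lemma mpoly_at_eq_linearization: "mpoly_at f x = linearization (\<lambda>\<alpha>. monomial_at \<alpha> x) f"
  by (simp add: mpoly_at_def linearization_def)

end

theory Submission
  imports Defs
begin

text \<open>
  A point evaluation at \<open>x \<in> K\<close> satisfies the inequalities, and these are preserved by convex
  combinations. Conversely, let \<open>L = L\<^sub>v\<close> be nonnegative on all \<open>g\<^sup>\<beta>\<close>. It suffices to show that
  \<open>L f \<ge> 0\<close> for every polynomial \<open>f\<close> that is positive on \<open>K\<close> (Handelman's theorem in dual form),
  because the point of the compact convex moment body nearest to \<open>v\<^sub>A\<close> would otherwise yield a
  separating \<open>f\<close>.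

  By Farkas' lemma one can scale the \<open>g\<^sub>i\<close> and add one further affine polynomial to obtain
  \<open>t\<^sub>i\<close> with sum \<open>1\<close> in the cone generated by \<open>1\<close> and the \<open>g\<^sub>i\<close>, and the variables are linear
  combinations \<open>x = \<Sum>\<^sub>i t\<^sub>i y\<^sub>i\<close>. The values of \<open>L\<close> on products of \<open>N\<close> of the \<open>t\<^sub>i\<close> are an exchangeable
  probability distribution on words of length \<open>N\<close>. As in de Finetti's theorem (or in the
  convergence of Bernstein polynomials), \<open>L f\<close> is the limit of the expectations of \<open>f\<close> at the mean
  \<open>z\<close> of the \<open>y\<^sub>i\<close> over the letters of the word. Finally \<open>z\<close> concentrates near \<open>K\<close>, where
  \<open>f > 0\<close>: substituting \<open>x = \<Sum>\<^sub>k t\<^sub>k y\<^sub>k\<close> in the affine polynomial \<open>t\<^sub>i\<close> gives back \<open>t\<^sub>i\<close>, so the mean square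
  difference between \<open>t\<^sub>i(z)\<close> and the frequency of the letter \<open>i\<close> tends to \<open>0\<close>.
\<close>

section \<open>Functionals on products of barycentric coordinates\<close>

text \<open>Isolates what the de Finetti argument uses; it is applied with
  \<open>linearization v\<close> for \<open>L\<close> and \<open>Poly_Mapping.single 0\<close> for
  \<open>const\<close>. A word \<open>w\<close> encodes a product of \<open>N\<close> of the
  \<open>t i\<close>.\<close>

locale barycentric_functional =
  fixes L :: "'a::comm_ring_1 \<Rightarrow> real"
    and const :: "real \<Rightarrow> 'a"
    and I :: "'i set"
    and t :: "'i \<Rightarrow> 'a"
  assumes L_add: "L (x + y) = L x + L y"
    and L_const_mult: "L (const c * x) = c * L x"
    and L_one: "L 1 = 1"
    and const_one: "const 1 = 1"
    and const_mult: "const (c * d) = const c * const d"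
    and finite_I: "finite I"
    and sum_t: "sum t I = 1"
    and L_prod_nonneg: "\<And>(N::nat) w. w \<in> {..<N} \<rightarrow>\<^sub>E I \<Longrightarrow> 0 \<le> L (\<Prod>m<N. t (w m))"
begin

definition words :: "nat \<Rightarrow> (nat \<Rightarrow> 'i) set" where
  "words N = {..<N} \<rightarrow>\<^sub>E I"

definition weight :: "nat \<Rightarrow> (nat \<Rightarrow> 'i) \<Rightarrow> real" where
  "weight N w = L (\<Prod>m<N. t (w m))"

lemma finite_words: "finite (words N)"
  by (simp add: words_def finite_PiE finite_I)

lemma weight_nonneg: "w \<in> words N \<Longrightarrow> 0 \<le> weight N w"
  by (simp add: words_def weight_def L_prod_nonneg)

lemma L_zero: "L 0 = 0"
  using L_add[of 0 0] by simp

lemma L_sum: "L (sum f S) = (\<Sum>x\<in>S. L (f x))"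
  by (induction S rule: infinite_finite_induct) (simp_all add: L_zero L_add)

lemma const_prod: "const (prod f S) = (\<Prod>x\<in>S. const (f x))"
  by (induction S rule: infinite_finite_induct) (simp_all add: const_one const_mult)

text \<open>Multiplying out the product on the right gives one term per word. Read backwards, the
  expectation of a product of functions of single letters becomes one value of
  \<open>L\<close>.\<close>

lemma sum_weight_prod:
  "(\<Sum>w\<in>words N. weight N w * (\<Prod>m<N. b m (w m))) = L (\<Prod>m<N. \<Sum>i\<in>I. const (b m i) * t i)"
proof -
  have "(\<Prod>m<N. \<Sum>i\<in>I. const (b m i) * t i)
      = (\<Sum>w\<in>words N. \<Prod>m<N. const (b m (w m)) * t (w m))"
    unfolding words_def by (rule prod_sum_PiE) (auto simp: finite_I)
  also have "\<dots> = (\<Sum>w\<in>words N. const (\<Prod>m<N. b m (w m)) * (\<Prod>m<N. t (w m)))"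
    by (simp add: prod.distrib const_prod)
  finally show ?thesis
    by (simp add: L_sum L_const_mult weight_def mult.commute[of "L _"])
qed

lemma sum_weight: "(\<Sum>w\<in>words N. weight N w) = 1"
  using sum_weight_prod[of N "\<lambda>_ _. 1"] by (simp add: const_one sum_t L_one)

text \<open>A position that \<open>\<phi>\<close> misses gets the factor \<open>1\<close>, which on
  the polynomial side is \<open>sum t I = 1\<close>, so it integrates out. Hence the value is the
  same for every \<open>N\<close> and every injective \<open>\<phi>\<close>: this is
  exchangeability.\<close>

lemma sum_weight_prod_inj:
  assumes "finite J" and inj: "inj_on \<phi> J" and ran: "\<phi> ` J \<subseteq> {..<N}"
  shows "(\<Sum>w\<in>words N. weight N w * (\<Prod>j\<in>J. a j (w (\<phi> j))))
    = L (\<Prod>j\<in>J. \<Sum>i\<in>I. const (a j i) * t i)"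
proof -
  define b where "b m i = (if m \<in> \<phi> ` J then a (inv_into J \<phi> m) i else 1)" for m i
  have *: "(\<Prod>m<N. F m) = (\<Prod>j\<in>J. F (\<phi> j))" if "\<And>m. m \<notin> \<phi> ` J \<Longrightarrow> F m = 1"
    for F :: "nat \<Rightarrow> 'z::comm_monoid_mult"
  proof -
    have "(\<Prod>m<N. F m) = (\<Prod>m\<in>\<phi> ` J. F m)"
      using that ran by (intro prod.mono_neutral_right) auto
    then show ?thesis
      by (simp add: prod.reindex[OF inj])
  qed
  have "(\<Prod>m<N. b m (w m)) = (\<Prod>j\<in>J. a j (w (\<phi> j)))" for w
    by (subst *) (auto simp: b_def inj intro!: prod.cong)
  moreover have "(\<Prod>m<N. \<Sum>i\<in>I. const (b m i) * t i) = (\<Prod>j\<in>J. \<Sum>i\<in>I. const (a j i) * t i)"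
    by (subst *) (auto simp: b_def inj const_one sum_t intro!: prod.cong)
  ultimately show ?thesis
    using sum_weight_prod[of N b] by simp
qed

text \<open>Only index maps \<open>\<phi>\<close> that fail to be injective contribute an error, and their proportion
  tends to \<open>0\<close>.\<close>

lemma tendsto_expectation_averages:
  assumes J: "finite J"
  shows "(\<lambda>N. \<Sum>w\<in>words N. weight N w * (\<Prod>j\<in>J. (\<Sum>m<N. a j (w m)) / real N))
    \<longlonglongrightarrow> L (\<Prod>j\<in>J. \<Sum>i\<in>I. const (a j i) * t i)"
proof -
  define lim where "lim = L (\<Prod>j\<in>J. \<Sum>i\<in>I. const (a j i) * t i)"
  define e where "e N \<phi> = (\<Sum>w\<in>words N. weight N w * (\<Prod>j\<in>J. a j (w (\<phi> j))))" for N \<phi>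
  \<comment> \<open>Bounds every product of values of the \<open>a j\<close> at letters of
    \<open>I\<close>, whatever \<open>N\<close> and \<open>\<phi>\<close> are.\<close>
  define B where "B = (\<Prod>j\<in>J. \<Sum>i\<in>I. \<bar>a j i\<bar>)"
  define F where "F N = (J \<rightarrow>\<^sub>E {..<N})" for N :: nat
  define G where "G N = {\<phi> \<in> F N. inj_on \<phi> J}" for N
  have finF: "finite (F N)" for N by (simp add: F_def finite_PiE J)
  have GF: "G N \<subseteq> F N" for N by (auto simp: G_def)
  have finG: "finite (G N)" for N using finF GF finite_subset by blast
  have cardF: "real (card (F N)) = real N ^ card J" for N
    by (simp add: F_def card_funcsetE J)
  have e_inj: "e N \<phi> = lim" if "\<phi> \<in> G N" for N \<phi>
    unfolding e_def lim_def using that J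
    by (intro sum_weight_prod_inj) (auto simp: G_def F_def PiE_def Pi_def)
  have e_bound: "\<bar>e N \<phi>\<bar> \<le> B" if "\<phi> \<in> F N" for N \<phi>
  proof -
    have "\<bar>\<Prod>j\<in>J. a j (w (\<phi> j))\<bar> \<le> B" if w: "w \<in> words N" for w
      unfolding abs_prod B_def
    proof (intro prod_mono conjI)
      fix j assume "j \<in> J"
      then have "w (\<phi> j) \<in> I" using w \<open>\<phi> \<in> F N\<close> by (auto simp: words_def F_def PiE_def Pi_def)
      then show "\<bar>a j (w (\<phi> j))\<bar> \<le> (\<Sum>i\<in>I. \<bar>a j i\<bar>)"
        using finite_I by (intro member_le_sum) auto
    qed simp
    then have "\<bar>e N \<phi>\<bar> \<le> (\<Sum>w\<in>words N. weight N w * B)"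
      unfolding e_def
      by (intro order_trans[OF sum_abs] sum_mono)
        (auto simp: abs_mult weight_nonneg intro!: mult_left_mono)
    also have "\<dots> = B" by (simp add: sum_weight flip: sum_distrib_right)
    finally show ?thesis .
  qed
  \<comment> \<open>Multiplying out the averages gives one term for each map \<open>\<phi>\<close>
    from \<open>J\<close> to the positions, so the expectation becomes the mean of
    \<open>e N \<phi>\<close> over all maps.\<close>
  have expand: "(\<Sum>w\<in>words N. weight N w * (\<Prod>j\<in>J. (\<Sum>m<N. a j (w m)) / real N))
      = (\<Sum>\<phi>\<in>F N. e N \<phi>) / real N ^ card J" for N
  proof -
    have "(\<Prod>j\<in>J. \<Sum>m<N. a j (w m)) = (\<Sum>\<phi>\<in>F N. \<Prod>j\<in>J. a j (w (\<phi> j)))" for w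
      unfolding F_def by (rule prod_sum_PiE) (auto simp: J)
    then have "(\<Sum>w\<in>words N. weight N w * (\<Prod>j\<in>J. (\<Sum>m<N. a j (w m)) / real N))
      = (\<Sum>w\<in>words N. \<Sum>\<phi>\<in>F N. weight N w * (\<Prod>j\<in>J. a j (w (\<phi> j)))) / real N ^ card J"
      by (simp add: prod_dividef sum_divide_distrib sum_distrib_left flip: sum_divide_distrib)
    also have "\<dots> = (\<Sum>\<phi>\<in>F N. e N \<phi>) / real N ^ card J"
      unfolding e_def by (subst sum.swap) simp
    finally show ?thesis .
  qed
  define r where "r N = real (card (G N)) / real N ^ card J" for N
  have "r \<longlonglongrightarrow> 1"
  proof -
    have r_eq: "r N = (\<Prod>i = 0..<card J. real (N - i) / real N)" for N
      using card_inj_on_subset_funcset[of J "{..<N}" J] J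
      by (simp add: r_def G_def F_def prod_dividef)
    have "(\<lambda>N. real (N - i) / real N) \<longlonglongrightarrow> 1" for i
    proof (rule Lim_transform_eventually)
      show "(\<lambda>N. 1 - real i / real N) \<longlonglongrightarrow> 1"
        using tendsto_diff[OF tendsto_const lim_const_over_n[of "real i"], of 1] by simp
      \<comment> \<open>Subtraction in the naturals agrees with the real one once
        \<open>i < N\<close>.\<close>
      show "eventually (\<lambda>N. 1 - real i / real N = real (N - i) / real N) sequentially"
        using eventually_gt_at_top[of i] by eventually_elim (simp add: field_simps of_nat_diff)
    qed
    then have "(\<lambda>N. \<Prod>i = 0..<card J. real (N - i) / real N) \<longlonglongrightarrow> (\<Prod>i = 0..<card J. 1)"
      by (intro tendsto_prod)
    then show ?thesis by (simp add: r_eq[abs_def])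
  qed
  have "(\<lambda>N. (1 - r N) * (B + \<bar>lim\<bar>)) \<longlonglongrightarrow> (1 - 1) * (B + \<bar>lim\<bar>)"
    by (intro tendsto_intros \<open>r \<longlonglongrightarrow> 1\<close>)
  then have bound_lim: "(\<lambda>N. (1 - r N) * (B + \<bar>lim\<bar>)) \<longlonglongrightarrow> 0" by simp
  have "eventually (\<lambda>N. norm ((\<Sum>\<phi>\<in>F N. e N \<phi>) / real N ^ card J - lim)
      \<le> (1 - r N) * (B + \<bar>lim\<bar>)) sequentially"
    using eventually_gt_at_top[of 0]
  proof eventually_elim
    fix N :: nat assume "0 < N"
    then have Npos: "0 < real N ^ card J" by simp
    have "(\<Sum>\<phi>\<in>F N. e N \<phi>) - real N ^ card J * lim = (\<Sum>\<phi>\<in>F N. e N \<phi> - lim)"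
      by (simp add: sum_subtractf cardF)
    \<comment> \<open>Injective maps give \<open>lim\<close> exactly, so only the others contribute;
      each is off by at most \<open>B + \<bar>lim\<bar>\<close>.\<close>
    also have "\<dots> = (\<Sum>\<phi>\<in>F N - G N. e N \<phi> - lim)"
      using finF GF e_inj by (intro sum.mono_neutral_right) auto
    finally have "\<bar>(\<Sum>\<phi>\<in>F N. e N \<phi>) - real N ^ card J * lim\<bar>
        \<le> (\<Sum>\<phi>\<in>F N - G N. \<bar>e N \<phi> - lim\<bar>)"
      by (simp add: sum_abs)
    also have "\<dots> \<le> (\<Sum>\<phi>\<in>F N - G N. B + \<bar>lim\<bar>)"
    proof (rule sum_mono)
      fix \<phi> assume "\<phi> \<in> F N - G N"
      then show "\<bar>e N \<phi> - lim\<bar> \<le> B + \<bar>lim\<bar>" using e_bound[of \<phi> N] by auto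
    qed
    also have "\<dots> = (real N ^ card J - real (card (G N))) * (B + \<bar>lim\<bar>)"
      using card_mono[OF finF GF, of N]
      by (simp add: card_Diff_subset finG GF of_nat_diff cardF)
    finally have "\<bar>(\<Sum>\<phi>\<in>F N. e N \<phi>) - real N ^ card J * lim\<bar> / real N ^ card J
      \<le> (real N ^ card J - real (card (G N))) * (B + \<bar>lim\<bar>) / real N ^ card J"
      using Npos by (intro divide_right_mono) auto
    moreover have "(\<Sum>\<phi>\<in>F N. e N \<phi>) / real N ^ card J - lim
        = ((\<Sum>\<phi>\<in>F N. e N \<phi>) - real N ^ card J * lim) / real N ^ card J"
      using \<open>0 < N\<close> by (simp add: field_simps)
    moreover have "(real N ^ card J - real (card (G N))) * (B + \<bar>lim\<bar>) / real N ^ card J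
        = (1 - r N) * (B + \<bar>lim\<bar>)"
      using \<open>0 < N\<close> by (simp add: r_def field_simps)
    ultimately show "norm ((\<Sum>\<phi>\<in>F N. e N \<phi>) / real N ^ card J - lim) \<le> (1 - r N) * (B + \<bar>lim\<bar>)"
      using Npos by (simp add: abs_divide)
  qed
  from Lim_null_comparison[OF this bound_lim] show ?thesis
    unfolding expand lim_def[symmetric] by (simp add: LIM_zero_iff)
qed

end

section \<open>The affine Farkas lemma\<close>

text \<open>Homogenise: the claim says that \<open>(q, p)\<close> lies in the cone generated by
  \<open>(1, 0)\<close> and the \<open>(b i, a i)\<close>. This cone is closed, being finitely
  generated, so otherwise some \<open>(u, y)\<close> separates. If \<open>u > 0\<close>, then
  \<open>y /\<^sub>R u\<close> is a point of \<open>K\<close> where the function is negative; if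
  \<open>u = 0\<close>, then \<open>y\<close> is a recession direction of \<open>K\<close> along
  which it decreases without bound.\<close>

lemma affine_farkas:
  fixes a :: "nat \<Rightarrow> 'a::euclidean_space" and b :: "nat \<Rightarrow> real"
  assumes K: "K = {x. \<forall>i<s. 0 \<le> b i + a i \<bullet> x}" and "K \<noteq> {}"
    and nonneg: "\<And>x. x \<in> K \<Longrightarrow> 0 \<le> q + p \<bullet> x"
  obtains d c where "0 \<le> d" and "\<And>i. 0 \<le> c i"
    and "q = d + (\<Sum>i<s. c i * b i)" and "p = (\<Sum>i<s. c i *\<^sub>R a i)"
proof -
  define W where "W = {(d + (\<Sum>i<s. c i * b i), \<Sum>i<s. c i *\<^sub>R a i) | d c.
    0 \<le> d \<and> (\<forall>i. 0 \<le> c i)}"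
  define S where "S = insert (1, 0) ((\<lambda>i. (b i, a i)) ` {..<s})"
  have "convex_cone W"
    unfolding convex_cone_iff
  proof (intro conjI ballI allI impI)
    show "0 \<in> W" unfolding W_def by (auto simp: zero_prod_def intro!: exI[of _ 0] exI[of _ "\<lambda>_. 0"])
  next
    fix x y assume "x \<in> W" "y \<in> W"
    then obtain d c d' c' where
      "x = (d + (\<Sum>i<s. c i * b i), \<Sum>i<s. c i *\<^sub>R a i)" "0 \<le> d" "\<forall>i. 0 \<le> c i"
      "y = (d' + (\<Sum>i<s. c' i * b i), \<Sum>i<s. c' i *\<^sub>R a i)" "0 \<le> d'" "\<forall>i. 0 \<le> c' i"
      unfolding W_def by blast
    then show "x + y \<in> W" unfolding W_def
      by (auto simp: algebra_simps sum.distrib intro!: exI[of _ "d + d'"] exI[of _ "\<lambda>i. c i + c' i"])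
  next
    fix x and r :: real assume "x \<in> W" "0 \<le> r"
    then obtain d c where
      "x = (d + (\<Sum>i<s. c i * b i), \<Sum>i<s. c i *\<^sub>R a i)" "0 \<le> d" "\<forall>i. 0 \<le> c i"
      unfolding W_def by blast
    then show "r *\<^sub>R x \<in> W" unfolding W_def using \<open>0 \<le> r\<close>
      by (auto simp: algebra_simps sum_distrib_left scaleR_sum_right
          intro!: exI[of _ "r * d"] exI[of _ "\<lambda>i. r * c i"])
  qed
  moreover have "S \<subseteq> W"
  proof -
    have "(1, 0) \<in> W" unfolding W_def by (auto intro!: exI[of _ 1] exI[of _ "\<lambda>_. 0"])
    moreover have "(b i, a i) \<in> W" if "i < s" for i
    proof -
      have "(b i, a i) = (0 + (\<Sum>j<s. (if j = i then 1 else 0) * b j),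
          \<Sum>j<s. (if j = i then 1 else 0) *\<^sub>R a j)"
        using that by (simp add: if_distrib[where f = "\<lambda>x. x *\<^sub>R _"]
            if_distrib[where f = "\<lambda>x. x * _"] cong: if_cong)
      then show ?thesis unfolding W_def
        by (intro CollectI exI[of _ 0] exI[of _ "\<lambda>j. if j = i then 1 else 0"]) simp
    qed
    ultimately show ?thesis by (auto simp: S_def)
  qed
  ultimately have sub: "convex_cone hull S \<subseteq> W" by (rule hull_minimal[rotated])
  have "(q, p) \<in> convex_cone hull S"
  proof (rule ccontr)
    assume "(q, p) \<notin> convex_cone hull S"
    moreover have "closed (convex_cone hull S)"
      by (rule closed_convex_cone_hull) (simp add: S_def)
    ultimately obtain h \<gamma> where h: "h \<bullet> (q, p) < \<gamma>" "\<And>x. x \<in> convex_cone hull S \<Longrightarrow> \<gamma> < h \<bullet> x"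
      using separating_hyperplane_closed_point[OF convex_convex_cone_hull] by metis
    have "\<gamma> < 0" using h(2)[OF convex_cone_hull_contains_0] by simp
    \<comment> \<open>A generator with negative value could be rescaled to have value exactly
      \<open>\<gamma>\<close>, against strict separation.\<close>
    have pos: "0 \<le> h \<bullet> x" if "x \<in> S" for x
    proof (rule ccontr)
      assume neg: "\<not> 0 \<le> h \<bullet> x"
      have "(\<gamma> / (h \<bullet> x)) *\<^sub>R x \<in> convex_cone hull S"
        using that neg \<open>\<gamma> < 0\<close> by (intro convex_cone_hull_mul hull_inc) (auto simp: divide_nonpos_nonpos)
      from h(2)[OF this] neg show False by simp
    qed
    obtain u y where hy: "h = (u, y)" by (cases h)
    have u: "0 \<le> u" using pos[of "(1, 0)"] by (simp add: S_def hy)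
    have ai: "0 \<le> u * b i + a i \<bullet> y" if "i < s" for i
      using pos[of "(b i, a i)"] that by (simp add: S_def hy inner_commute)
    have neg: "u * q + p \<bullet> y < 0" using h(1) \<open>\<gamma> < 0\<close> by (simp add: hy inner_commute mult.commute)
    show False
    proof (cases "u = 0")
      case False
      with u have "0 < u" by simp
      have "y /\<^sub>R u \<in> K" unfolding K using ai \<open>0 < u\<close>
        by (auto simp: field_simps)
      from nonneg[OF this] neg \<open>0 < u\<close> show False by (simp add: field_simps)
    next
      case True
      then have "p \<bullet> y < 0" using neg by simp
      then have "y \<noteq> 0" by auto
      obtain x0 where "x0 \<in> K" using \<open>K \<noteq> {}\<close> by blast
      have ray: "x0 + r *\<^sub>R y \<in> K" if "0 \<le> r" for r
      proof -
        have "0 \<le> (b i + a i \<bullet> x0) + r * (a i \<bullet> y)" if "i < s" for i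
          using that ai[OF that] True \<open>x0 \<in> K\<close> \<open>0 \<le> r\<close>
          by (intro add_nonneg_nonneg[of "b i + a i \<bullet> x0"] mult_nonneg_nonneg) (auto simp: K)
        then show ?thesis by (simp add: K inner_add_right algebra_simps)
      qed
      have "0 \<le> q + p \<bullet> x0" by (rule nonneg) fact
      \<comment> \<open>At this distance along the ray the function takes the value
        \<open>-1\<close>.\<close>
      define r where "r = (q + p \<bullet> x0 + 1) / - (p \<bullet> y)"
      have "0 \<le> r" using \<open>p \<bullet> y < 0\<close> \<open>0 \<le> q + p \<bullet> x0\<close>
        by (simp add: r_def divide_nonneg_neg field_simps)
      from nonneg[OF ray[OF this]] have "0 \<le> q + p \<bullet> x0 + r * (p \<bullet> y)"
        by (simp add: inner_add_right algebra_simps)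
      also have "r * (p \<bullet> y) = - (q + p \<bullet> x0 + 1)"
        using \<open>p \<bullet> y < 0\<close> by (simp add: r_def field_simps)
      finally show False by simp
    qed
  qed
  then have "(q, p) \<in> W" using sub by blast
  then show ?thesis unfolding W_def using that by blast
qed

section \<open>Affine polynomials\<close>

lemma sum_single_lookup: "f = (\<Sum>k\<in>Poly_Mapping.keys f. Poly_Mapping.single k (Poly_Mapping.lookup f k))"
  by (rule poly_mapping_eqI) (auto simp: lookup_sum lookup_single when_def in_keys_iff)

lemma linearization_zero [simp]: "linearization v 0 = 0"
  by (simp add: linearization_def)

lemma linearization_sum: "linearization v (sum f S) = (\<Sum>x\<in>S. linearization v (f x))"
  by (induction S rule: infinite_finite_induct) (simp_all add: linearization_add)

lemma linearization_const_mult: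
  "linearization v (Poly_Mapping.single 0 c * f) = c * linearization v f"
proof -
  have "linearization v (Poly_Mapping.single 0 c * (\<Sum>k\<in>S. Poly_Mapping.single k (h k)))
      = c * linearization v (\<Sum>k\<in>S. Poly_Mapping.single k (h k))" for S h
    by (simp add: sum_distrib_left mult_single linearization_sum linearization_single mult.assoc)
  from this[where S = "Poly_Mapping.keys f" and h = "Poly_Mapping.lookup f"] show ?thesis
    by (simp flip: sum_single_lookup)
qed

text \<open>By bilinearity it suffices that \<open>v\<close> is multiplicative on exponents, as it
  is for point evaluations.\<close>

lemma linearization_mult:
  assumes "\<And>a b. v (a + b) = v a * v b"
  shows "linearization v (f * h) = linearization v f * linearization v h"
proof -
  have "linearization v ((\<Sum>k\<in>S. Poly_Mapping.single k (p k)) * (\<Sum>k\<in>T. Poly_Mapping.single k (q k)))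
     = linearization v (\<Sum>k\<in>S. Poly_Mapping.single k (p k))
       * linearization v (\<Sum>k\<in>T. Poly_Mapping.single k (q k))" for S T p q
    by (simp add: sum_product mult_single linearization_sum linearization_single assms mult_ac)
  from this[where S = "Poly_Mapping.keys f" and p = "Poly_Mapping.lookup f"
      and T = "Poly_Mapping.keys h" and q = "Poly_Mapping.lookup h"] show ?thesis
    by (simp flip: sum_single_lookup)
qed

lemma monomial_at_zero [simp]: "monomial_at 0 x = 1"
  by (simp add: monomial_at_def)

lemma monomial_at_add: "monomial_at (\<alpha> + \<beta>) x = monomial_at \<alpha> x * monomial_at \<beta> x"
  by (simp add: monomial_at_def lookup_add power_add prod.distrib)

lemma mpoly_at_mult: "mpoly_at (f * h) x = mpoly_at f x * mpoly_at h x"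
  by (simp add: mpoly_at_eq_linearization linearization_mult monomial_at_add)

lemma mpoly_at_one [simp]: "mpoly_at 1 x = 1"
  using linearization_single[of "\<lambda>\<alpha>. monomial_at \<alpha> x" 0 1]
  by (simp add: mpoly_at_eq_linearization)

lemma mpoly_at_power: "mpoly_at (f ^ k) x = mpoly_at f x ^ k"
  by (induction k) (simp_all add: mpoly_at_mult)

lemma mpoly_at_prod: "mpoly_at (prod f S) x = (\<Prod>i\<in>S. mpoly_at (f i) x)"
  by (induction S rule: infinite_finite_induct) (simp_all add: mpoly_at_mult)

definition poly_var :: "'n::finite \<Rightarrow> 'n mpoly" where
  "poly_var j = Poly_Mapping.single (Poly_Mapping.single j 1) 1"

definition affine_poly :: "real \<Rightarrow> real^'n::finite \<Rightarrow> 'n mpoly" where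
  "affine_poly b a = Poly_Mapping.single 0 b + (\<Sum>j\<in>UNIV. Poly_Mapping.single 0 (a $ j) * poly_var j)"

lemma monomial_at_single: "monomial_at (Poly_Mapping.single j 1) x = x $ j"
proof -
  have "monomial_at (Poly_Mapping.single j 1) x = (\<Prod>i\<in>UNIV. if i = j then x $ j else 1)"
    unfolding monomial_at_def by (rule prod.cong) (auto simp: lookup_single)
  then show ?thesis by simp
qed

lemma mpoly_at_affine_poly: "mpoly_at (affine_poly b a) x = b + a \<bullet> x"
proof -
  have "mpoly_at (affine_poly b a) x = b + (\<Sum>j\<in>UNIV. a $ j * x $ j)"
    by (simp add: mpoly_at_eq_linearization affine_poly_def poly_var_def linearization_add
        linearization_sum linearization_const_mult linearization_single monomial_at_single
        del: One_nat_def)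
  then show ?thesis by (simp add: inner_vec_def)
qed

lemma affine_poly_add: "affine_poly b a + affine_poly b' a' = affine_poly (b + b') (a + a')"
  by (simp add: affine_poly_def single_add sum.distrib algebra_simps)

lemma const_mult_affine_poly:
  "Poly_Mapping.single 0 c * affine_poly b a = affine_poly (c * b) (c *\<^sub>R a)"
  by (simp add: affine_poly_def distrib_left sum_distrib_left mult_single flip: mult.assoc)

lemma affine_poly_zero [simp]: "affine_poly 0 0 = 0"
  by (simp add: affine_poly_def)

lemma affine_poly_const: "affine_poly b 0 = Poly_Mapping.single 0 b"
  by (simp add: affine_poly_def)

lemma affine_poly_axis: "affine_poly 0 (axis j 1) = poly_var j"
proof -
  have "Poly_Mapping.single 0 (axis j 1 $ k) * poly_var k = (if k = j then poly_var j else 0)" for k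
    by (simp add: axis_def)
  then show ?thesis by (simp add: affine_poly_def)
qed

lemma affine_poly_sum: "(\<Sum>i\<in>S. affine_poly (b i) (a i)) = affine_poly (sum b S) (sum a S)"
  by (induction S rule: infinite_finite_induct) (simp_all add: affine_poly_add)

lemma multiindex_degree_le_one:
  fixes \<alpha> :: "'n::finite \<Rightarrow>\<^sub>0 nat"
  assumes "(\<Sum>i\<in>UNIV. Poly_Mapping.lookup \<alpha> i) \<le> 1"
  shows "\<alpha> = 0 \<or> (\<exists>j. \<alpha> = Poly_Mapping.single j 1)"
proof (cases "\<alpha> = 0")
  case False
  then obtain j where j: "Poly_Mapping.lookup \<alpha> j \<noteq> 0"
    by (metis lookup_zero poly_mapping_eqI)
  have "(\<Sum>i\<in>UNIV. Poly_Mapping.lookup \<alpha> i)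
      = Poly_Mapping.lookup \<alpha> j + (\<Sum>i\<in>UNIV - {j}. Poly_Mapping.lookup \<alpha> i)"
    by (simp add: sum.remove)
  with assms j have "Poly_Mapping.lookup \<alpha> j = 1" "(\<Sum>i\<in>UNIV - {j}. Poly_Mapping.lookup \<alpha> i) = 0"
    by linarith+
  then have "\<alpha> = Poly_Mapping.single j 1"
    by (intro poly_mapping_eqI) (auto simp: lookup_single when_def)
  then show ?thesis by blast
qed simp

lemma affine_poly_of_total_degree:
  assumes "total_degree f \<le> 1"
  shows "\<exists>b a. f = affine_poly b a"
proof -
  define a :: "real^'a" where "a = (\<chi> j. Poly_Mapping.lookup f (Poly_Mapping.single j 1))"
  \<comment> \<open>The multi-indices of degree at most one; \<open>inj\<close> and
    \<open>nz\<close> ensure that each is counted once.\<close>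
  let ?E = "insert 0 (range (\<lambda>j::'a. Poly_Mapping.single j (1::nat)))"
  have inj: "inj (\<lambda>j::'a. Poly_Mapping.single j (1::nat))"
    by (rule injI) (metis lookup_single_eq lookup_single_not_eq zero_neq_one)
  have nz: "0 \<notin> range (\<lambda>j::'a. Poly_Mapping.single j (1::nat))"
    by (metis (no_types, lifting) imageE lookup_single_eq lookup_zero zero_neq_one)
  have "Poly_Mapping.keys f \<subseteq> ?E"
  proof
    fix \<alpha> assume \<alpha>: "\<alpha> \<in> Poly_Mapping.keys f"
    have "(\<Sum>i\<in>UNIV. Poly_Mapping.lookup \<alpha> i) \<le> total_degree f"
      unfolding total_degree_def using \<alpha> by (intro Max_ge) auto
    then have "(\<Sum>i\<in>UNIV. Poly_Mapping.lookup \<alpha> i) \<le> 1" using assms by linarith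
    then show "\<alpha> \<in> ?E" using multiindex_degree_le_one[of \<alpha>] by auto
  qed
  then have "f = (\<Sum>k\<in>?E. Poly_Mapping.single k (Poly_Mapping.lookup f k))"
    by (subst sum_single_lookup, intro sum.mono_neutral_left) (auto simp: in_keys_iff)
  also have "\<dots> = affine_poly (Poly_Mapping.lookup f 0) a"
    using nz by (simp add: sum.reindex[OF inj] affine_poly_def poly_var_def a_def mult_single
        del: One_nat_def)
  finally show ?thesis by blast
qed

section \<open>Positivity on barycentric coordinates and on polytopes\<close>

lemma poly_var_power: "poly_var j ^ k = Poly_Mapping.single (Poly_Mapping.single j k) 1"
  by (induction k) (simp_all add: poly_var_def mult_single single_add[symmetric])

text \<open>Spells a monomial as a product of variables repeated according to its exponents, the
  shape to which \<open>tendsto_expectation_averages\<close> applies.\<close>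

lemma prod_poly_var_power:
  "(\<Prod>j\<in>UNIV. poly_var j ^ Poly_Mapping.lookup \<alpha> j) = Poly_Mapping.single \<alpha> 1"
proof -
  have "(\<Prod>j\<in>S. Poly_Mapping.single (h j) (1::real)) = Poly_Mapping.single (sum h S) 1"
    for S :: "'a set" and h :: "'a \<Rightarrow> 'a \<Rightarrow>\<^sub>0 nat"
    by (induction S rule: infinite_finite_induct) (simp_all add: mult_single)
  moreover have "(\<Sum>j\<in>UNIV. Poly_Mapping.single j (Poly_Mapping.lookup \<alpha> j)) = \<alpha>"
    by (rule poly_mapping_eqI) (simp add: lookup_sum lookup_single when_def)
  ultimately show ?thesis by (simp add: poly_var_power)
qed

lemma continuous_on_monomial_at: "continuous_on S (monomial_at \<alpha>)"
  unfolding monomial_at_def by (intro continuous_intros)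

text \<open>On the compact set where \<open>f \<le> 0\<close>, \<open>h\<close> has a positive
  minimum and \<open>f\<close> is bounded below, so a large multiple of \<open>h\<close> outweighs
  \<open>f\<close>. Later \<open>h\<close> measures the violation of the inequalities.\<close>

lemma penalty_exists:
  fixes f h :: "'x::topological_space \<Rightarrow> real"
  assumes D: "compact D" and f: "continuous_on D f" and h: "continuous_on D h"
    and h_nonneg: "\<And>x. x \<in> D \<Longrightarrow> 0 \<le> h x"
    and pos: "\<And>x. x \<in> D \<Longrightarrow> h x = 0 \<Longrightarrow> 0 < f x"
  shows "\<exists>c\<ge>0. \<forall>x\<in>D. 0 \<le> f x + c * h x"
proof (cases "\<forall>x\<in>D. 0 \<le> f x")
  case True
  then show ?thesis by (intro exI[of _ 0]) simp
next
  case False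
  define Z where "Z = {x \<in> D. f x \<le> 0}"
  have "Z \<noteq> {}" using False by (auto simp: Z_def not_le intro: less_imp_le)
  have "compact Z"
  proof -
    obtain C where C: "closed C" "C \<inter> D = f -` {..0} \<inter> D"
      using f unfolding continuous_on_closed_invariant by (meson closed_atMost)
    then have "Z = D \<inter> C" by (auto simp: Z_def)
    with C D show ?thesis by (simp add: compact_Int_closed)
  qed
  have sub: "Z \<subseteq> D" by (auto simp: Z_def)
  obtain x1 where x1: "x1 \<in> Z" "\<And>x. x \<in> Z \<Longrightarrow> h x1 \<le> h x"
    using continuous_attains_inf[OF \<open>compact Z\<close> \<open>Z \<noteq> {}\<close> continuous_on_subset[OF h sub]] by blast
  obtain x2 where x2: "x2 \<in> Z" "\<And>x. x \<in> Z \<Longrightarrow> f x2 \<le> f x"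
    using continuous_attains_inf[OF \<open>compact Z\<close> \<open>Z \<noteq> {}\<close> continuous_on_subset[OF f sub]] by blast
  have "0 < h x1" using x1(1) h_nonneg[of x1] pos[of x1] by (force simp: Z_def)
  have "f x2 \<le> 0" using x2(1) by (simp add: Z_def)
  define c where "c = - f x2 / h x1"
  have "0 \<le> c" using \<open>0 < h x1\<close> \<open>f x2 \<le> 0\<close> by (simp add: c_def divide_nonpos_pos)
  have "0 \<le> f x + c * h x" if "x \<in> D" for x
  proof (cases "x \<in> Z")
    case True
    have "- f x2 = c * h x1" using \<open>0 < h x1\<close> by (simp add: c_def)
    also have "\<dots> \<le> c * h x" using x1(2)[OF True] \<open>0 \<le> c\<close> by (rule mult_left_mono)
    finally show ?thesis using x2(2)[OF True] by simp
  next
    case False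
    then have "0 \<le> f x" using that by (simp add: Z_def)
    then show ?thesis using \<open>0 \<le> c\<close> h_nonneg[OF that] by simp
  qed
  then show ?thesis using \<open>0 \<le> c\<close> by blast
qed

text \<open>The empirical points \<open>z N w\<close> need not satisfy \<open>0 \<le> b i + a i \<bullet> z N w\<close>. But
  \<open>b i + a i \<bullet> z N w\<close> minus the nonnegative frequency of the letter \<open>i\<close> is the average attached
  to a linear form in the \<open>t i\<close> that vanishes identically, so the mean square violation tends to
  \<open>0\<close>.\<close>

lemma linearization_nonneg_barycentric:
  fixes v :: "('n::finite \<Rightarrow>\<^sub>0 nat) \<Rightarrow> real" and t :: "'i \<Rightarrow> 'n mpoly"
  assumes bary: "barycentric_functional (linearization v) (Poly_Mapping.single 0) I t"
    and var: "\<And>j. poly_var j = (\<Sum>i\<in>I. Poly_Mapping.single 0 (y i $ j) * t i)"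
    and t: "\<And>i. i \<in> I \<Longrightarrow> t i = affine_poly (b i) (a i)"
    and pos: "\<And>x. (\<And>i. i \<in> I \<Longrightarrow> 0 \<le> b i + a i \<bullet> x) \<Longrightarrow> 0 < (\<Sum>\<alpha>\<in>B. f \<alpha> * monomial_at \<alpha> x)"
  shows "0 \<le> (\<Sum>\<alpha>\<in>B. f \<alpha> * v \<alpha>)"
proof -
  interpret barycentric_functional "linearization v" "Poly_Mapping.single 0" I t
    by (rule bary)
  define E where "E N F = (\<Sum>w\<in>words N. weight N w * F w)" for N and F :: "(nat \<Rightarrow> 'i) \<Rightarrow> real"
  define z where "z N w = (\<Sum>m<N. y (w m)) /\<^sub>R real N" for N and w :: "nat \<Rightarrow> 'i"
  define p where "p x = (\<Sum>\<alpha>\<in>B. f \<alpha> * monomial_at \<alpha> x)" for x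
  \<comment> \<open>The value at \<open>y k\<close> of the affine function \<open>t i\<close>, minus
    the indicator of the letter \<open>i\<close>. It would be \<open>0\<close> if the
    \<open>t i\<close> were the barycentric coordinates of a simplex with vertices
    \<open>y k\<close>.\<close>
  define l where "l i k = b i + a i \<bullet> y k - (if k = i then 1 else 0)" for i k
  define av where "av N w i = (\<Sum>m<N. l i (w m)) / real N" for N and w :: "nat \<Rightarrow> 'i" and i
  have mono: "(\<lambda>N. E N (\<lambda>w. monomial_at \<alpha> (z N w))) \<longlonglongrightarrow> v \<alpha>" for \<alpha>
  proof -
    \<comment> \<open>One element for each variable factor of the monomial: \<open>(j, k)\<close> is
      copy \<open>k\<close> of the variable \<open>j\<close>.\<close>
    define J where "J = Sigma UNIV (\<lambda>j. {..<Poly_Mapping.lookup \<alpha> j})"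
    have prod_J: "(\<Prod>(j, k)\<in>J. F j) = (\<Prod>j\<in>UNIV. F j ^ Poly_Mapping.lookup \<alpha> j)"
      for F :: "'n \<Rightarrow> 'z::comm_monoid_mult"
      unfolding J_def by (subst prod.Sigma[symmetric]) simp_all
    have 1: "(\<Prod>q\<in>J. (\<Sum>m<N. y (w m) $ fst q) / real N) = monomial_at \<alpha> (z N w)" for N w
      using prod_J[of "\<lambda>j. (\<Sum>m<N. y (w m) $ j) / real N"]
      by (simp add: monomial_at_def z_def case_prod_beta divide_inverse mult.commute)
    have 2: "linearization v (\<Prod>q\<in>J. \<Sum>i\<in>I. Poly_Mapping.single 0 (y i $ fst q) * t i) = v \<alpha>"
      using prod_J[of poly_var]
      by (simp add: case_prod_beta prod_poly_var_power linearization_single flip: var)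
    have "finite J" by (simp add: J_def)
    from tendsto_expectation_averages[OF this, of "\<lambda>q i. y i $ fst q"]
    show ?thesis unfolding E_def 1 2 .
  qed
  \<comment> \<open>Collecting terms with \<open>sum t I = 1\<close> and \<open>var\<close> turns
    the left side into \<open>affine_poly (b i) (a i) - t i\<close>.\<close>
  have vanish: "(\<Sum>k\<in>I. Poly_Mapping.single 0 (l i k) * t k) = 0" if "i \<in> I" for i
  proof -
    have "(\<Sum>k\<in>I. Poly_Mapping.single 0 (l i k) * t k)
      = Poly_Mapping.single 0 (b i) * sum t I
        + (\<Sum>k\<in>I. \<Sum>j\<in>UNIV. Poly_Mapping.single 0 (a i $ j) * (Poly_Mapping.single 0 (y k $ j) * t k))
        - (\<Sum>k\<in>I. if k = i then t i else 0)"
    proof -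
      have "Poly_Mapping.single 0 (l i k) * t k = Poly_Mapping.single 0 (b i) * t k
        + (\<Sum>j\<in>UNIV. Poly_Mapping.single 0 (a i $ j) * (Poly_Mapping.single 0 (y k $ j) * t k))
        - (if k = i then t i else 0)" for k
      proof -
        have "Poly_Mapping.single (0 :: 'n \<Rightarrow>\<^sub>0 nat) (a i \<bullet> y k)
          = (\<Sum>j\<in>UNIV. Poly_Mapping.single 0 (a i $ j) * Poly_Mapping.single 0 (y k $ j))"
          by (rule poly_mapping_eqI) (simp add: inner_vec_def mult_single lookup_sum lookup_single when_def)
        then show ?thesis
          by (simp add: l_def single_add single_diff algebra_simps sum_distrib_right sum_distrib_left)
      qed
      then show ?thesis by (simp add: sum.distrib sum_subtractf sum_distrib_left)
    qed
    also have "(\<Sum>k\<in>I. \<Sum>j\<in>UNIV. Poly_Mapping.single 0 (a i $ j) * (Poly_Mapping.single 0 (y k $ j) * t k))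
        = (\<Sum>j\<in>UNIV. Poly_Mapping.single 0 (a i $ j) * poly_var j)"
      by (subst sum.swap) (simp add: var sum_distrib_left)
    finally show ?thesis
      using that finite_I by (simp add: sum_t t[OF that] affine_poly_def)
  qed
  \<comment> \<open>Two equal factors give the second moment; its limit is the functional at the
    square of the zero polynomial.\<close>
  have square: "(\<lambda>N. E N (\<lambda>w. (av N w i)\<^sup>2)) \<longlonglongrightarrow> 0" if "i \<in> I" for i
    using tendsto_expectation_averages[of "{..<2::nat}" "\<lambda>_. l i"] vanish[OF that]
    by (simp add: E_def av_def L_zero power2_eq_square)
  \<comment> \<open>\<open>u\<close> is the frequency of the letter \<open>i\<close> in the word
    \<open>w\<close>.\<close>
  have av_eq: "\<exists>u\<ge>0. av N w i = b i + a i \<bullet> z N w - u" if "0 < N" for N w i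
  proof -
    have "av N w i = b i + a i \<bullet> z N w - (\<Sum>m<N. if w m = i then 1 else 0) / real N"
      using that
      by (simp add: av_def l_def z_def sum.distrib sum_subtractf inner_sum_right diff_divide_distrib
          add_divide_distrib divide_inverse mult.commute distrib_left right_diff_distrib)
    then show ?thesis
      by (intro exI[of _ "(\<Sum>m<N. if w m = i then 1 else 0) / real N"]) (auto intro!: sum_nonneg divide_nonneg_nonneg)
  qed
  \<comment> \<open>A compact set containing \<open>z N w\<close> for all words with
    \<open>0 < N\<close>, also where it violates an inequality.\<close>
  define D where "D = convex hull (y ` I)"
  have "compact D"
    unfolding D_def using finite_I by (intro finite_imp_compact_convex_hull) simp
  have z_D: "z N w \<in> D" if "w \<in> words N" "0 < N" for N w
  proof -
    have "(\<Sum>m<N. (1 / real N) *\<^sub>R y (w m)) \<in> D"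
      using that unfolding D_def words_def
      by (intro convex_sum convex_convex_hull) (auto intro!: hull_inc)
    then show ?thesis by (simp add: z_def scaleR_sum_right divide_inverse)
  qed
  \<comment> \<open>The total squared violation; it vanishes exactly where \<open>pos\<close>
    applies.\<close>
  define h where "h x = (\<Sum>i\<in>I. (min 0 (b i + a i \<bullet> x))\<^sup>2)" for x
  have "\<exists>c\<ge>0. \<forall>x\<in>D. 0 \<le> p x + c * h x"
  proof (rule penalty_exists[OF \<open>compact D\<close>])
    show "continuous_on D p"
      unfolding p_def by (intro continuous_intros continuous_on_monomial_at)
    show "continuous_on D h"
      unfolding h_def by (intro continuous_intros)
    show "0 \<le> h x" for x by (simp add: h_def sum_nonneg)
    show "0 < p x" if "h x = 0" for x
      using that finite_I unfolding p_def h_def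
      by (intro pos) (auto simp: sum_nonneg_eq_0_iff min_def split: if_splits)
  qed
  then obtain c where c: "0 \<le> c" "\<And>x. x \<in> D \<Longrightarrow> 0 \<le> p x + c * h x" by blast
  \<comment> \<open>The penalty has expectation tending to \<open>0\<close>, so it leaves the limit
    unchanged while making the expectations for \<open>0 < N\<close> nonnegative.\<close>
  have "(\<lambda>N. (\<Sum>\<alpha>\<in>B. f \<alpha> * E N (\<lambda>w. monomial_at \<alpha> (z N w)))
      + c * (\<Sum>i\<in>I. E N (\<lambda>w. (av N w i)\<^sup>2)))
    \<longlonglongrightarrow> (\<Sum>\<alpha>\<in>B. f \<alpha> * v \<alpha>) + c * (\<Sum>i\<in>I. 0)"
    by (intro tendsto_intros mono square)
  then have "(\<lambda>N. E N (\<lambda>w. p (z N w) + c * (\<Sum>i\<in>I. (av N w i)\<^sup>2))) \<longlonglongrightarrow> (\<Sum>\<alpha>\<in>B. f \<alpha> * v \<alpha>)"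
  proof -
    assume *: "(\<lambda>N. (\<Sum>\<alpha>\<in>B. f \<alpha> * E N (\<lambda>w. monomial_at \<alpha> (z N w)))
      + c * (\<Sum>i\<in>I. E N (\<lambda>w. (av N w i)\<^sup>2)))
      \<longlonglongrightarrow> (\<Sum>\<alpha>\<in>B. f \<alpha> * v \<alpha>) + c * (\<Sum>i\<in>I. 0)"
    have E_sum: "E N (\<lambda>w. \<Sum>k\<in>S. r k * F k w) = (\<Sum>k\<in>S. r k * E N (F k))"
      for N F r and S :: "'s set"
      unfolding E_def by (simp add: sum_distrib_left mult.left_commute) (rule sum.swap)
    have "E N (\<lambda>w. p (z N w) + c * (\<Sum>i\<in>I. (av N w i)\<^sup>2))
      = (\<Sum>\<alpha>\<in>B. f \<alpha> * E N (\<lambda>w. monomial_at \<alpha> (z N w))) + c * (\<Sum>i\<in>I. E N (\<lambda>w. (av N w i)\<^sup>2))" for N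
    proof -
      have "E N (\<lambda>w. p (z N w) + c * (\<Sum>i\<in>I. (av N w i)\<^sup>2))
        = E N (\<lambda>w. p (z N w)) + E N (\<lambda>w. \<Sum>i\<in>I. c * (av N w i)\<^sup>2)"
        by (simp add: E_def distrib_left sum.distrib sum_distrib_left)
      then show ?thesis by (simp only: p_def E_sum sum_distrib_left)
    qed
    with * show ?thesis by simp
  qed
  moreover have "eventually (\<lambda>N. 0 \<le> E N (\<lambda>w. p (z N w) + c * (\<Sum>i\<in>I. (av N w i)\<^sup>2))) sequentially"
    using eventually_gt_at_top[of 0]
  proof eventually_elim
    case (elim N)
    have "0 \<le> p (z N w) + c * (\<Sum>i\<in>I. (av N w i)\<^sup>2)" if "w \<in> words N" for w
    proof -
      \<comment> \<open>Subtracting \<open>u \<ge> 0\<close> from a negative number cannot decrease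
        its square; otherwise the left side is \<open>0\<close>.\<close>
      have "(min 0 (b i + a i \<bullet> z N w))\<^sup>2 \<le> (av N w i)\<^sup>2" for i
      proof -
        obtain u where "0 \<le> u" "av N w i = b i + a i \<bullet> z N w - u"
          using av_eq[OF elim] by blast
        then show ?thesis by (intro abs_le_square_iff[THEN iffD1]) (auto simp: min_def)
      qed
      then have "h (z N w) \<le> (\<Sum>i\<in>I. (av N w i)\<^sup>2)"
        unfolding h_def by (intro sum_mono)
      then have "c * h (z N w) \<le> c * (\<Sum>i\<in>I. (av N w i)\<^sup>2)"
        using c(1) by (rule mult_left_mono)
      with c(2)[OF z_D[OF that elim]] show ?thesis by linarith
    qed
    then show ?case unfolding E_def by (intro sum_nonneg mult_nonneg_nonneg weight_nonneg)
  qed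
  ultimately show ?thesis by (rule tendsto_lowerbound) simp
qed

section \<open>Handelman positivity on a polytope, in dual form\<close>

lemma power_product_Suc:
  "k < s \<Longrightarrow> power_product s g (\<beta>(k := Suc (\<beta> k))) = g k * power_product s g \<beta>"
proof -
  assume "k < s"
  then have *: "(\<Prod>i<s. F i) = F k * (\<Prod>i\<in>{..<s} - {k}. F i)" for F :: "nat \<Rightarrow> 'a"
    by (intro prod.remove) auto
  show ?thesis
    unfolding power_product_def by (subst (1 2) *) (simp add: mult.assoc)
qed

text \<open>In the induction \<open>\<beta>\<close> stays arbitrary, so that a factor
  \<open>g k\<close> split off from \<open>p m\<close> can be absorbed by raising
  \<open>\<beta> k\<close>; all coefficients that arise are nonnegative.\<close>

lemma linearization_prod_cone_nonneg:
  assumes v: "\<And>\<beta>. 0 \<le> linearization v (power_product s g \<beta>)"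
    and "finite S"
    and p: "\<And>m. m \<in> S \<Longrightarrow> \<exists>d c. 0 \<le> d \<and> (\<forall>k. 0 \<le> c k) \<and>
      p m = Poly_Mapping.single 0 d + (\<Sum>k<s. Poly_Mapping.single 0 (c k) * g k)"
  shows "0 \<le> linearization v (prod p S * power_product s g \<beta>)"
  using \<open>finite S\<close> p
proof (induction S arbitrary: \<beta> rule: finite_induct)
  case empty
  then show ?case by (simp add: v)
next
  case (insert m S)
  obtain d c where dc: "0 \<le> d" "\<forall>k. 0 \<le> c k"
    "p m = Poly_Mapping.single 0 d + (\<Sum>k<s. Poly_Mapping.single 0 (c k) * g k)"
    using insert.prems by blast
  have IH: "0 \<le> linearization v (prod p S * power_product s g \<beta>)" for \<beta>
    using insert by auto
  have "prod p (insert m S) * power_product s g \<beta> = p m * (prod p S * power_product s g \<beta>)"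
    using insert.hyps by (simp add: mult.assoc)
  also have "\<dots> = Poly_Mapping.single 0 d * (prod p S * power_product s g \<beta>)
      + (\<Sum>k<s. Poly_Mapping.single 0 (c k) * (g k * (prod p S * power_product s g \<beta>)))"
    by (simp add: dc(3) distrib_right sum_distrib_right mult.assoc)
  also have "\<dots> = Poly_Mapping.single 0 d * (prod p S * power_product s g \<beta>)
      + (\<Sum>k<s. Poly_Mapping.single 0 (c k) * (prod p S * power_product s g (\<beta>(k := Suc (\<beta> k)))))"
    by (simp add: power_product_Suc mult.left_commute)
  finally show ?case
    using dc IH
    by (simp add: linearization_add linearization_sum linearization_const_mult sum_nonneg)
qed

text \<open>\<open>affine_farkas\<close> supplies the data of
  \<open>linearization_nonneg_barycentric\<close> in two ways: applied to \<open>M\<close> minus the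
  sum of the \<open>g i\<close>, it completes the scaled \<open>g i\<close> to a partition of unity;
  applied to \<open>R\<close> plus a coordinate, it expresses the variable through the
  \<open>g i\<close>.\<close>

lemma linearization_nonneg_of_positive:
  fixes K :: "(real^'n) set" and g :: "nat \<Rightarrow> 'n mpoly"
  assumes "K \<noteq> {}" and "bounded K" and K: "K = {x. \<forall>i<s. 0 \<le> mpoly_at (g i) x}"
    and deg: "\<And>i. i < s \<Longrightarrow> total_degree (g i) \<le> 1"
    and v0: "v 0 = 1" and v: "\<And>\<beta>. 0 \<le> linearization v (power_product s g \<beta>)"
    and pos: "\<And>x. x \<in> K \<Longrightarrow> 0 < (\<Sum>\<alpha>\<in>B. f \<alpha> * monomial_at \<alpha> x)"
  shows "0 \<le> (\<Sum>\<alpha>\<in>B. f \<alpha> * v \<alpha>)"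
proof -
  obtain b a where g: "\<And>i. i < s \<Longrightarrow> g i = affine_poly (b i) (a i)"
    using affine_poly_of_total_degree[OF deg] by metis
  have K_eq: "K = {x. \<forall>i<s. 0 \<le> b i + a i \<bullet> x}"
    unfolding K by (auto simp: g mpoly_at_affine_poly)
  obtain R where R: "\<And>x. x \<in> K \<Longrightarrow> norm x \<le> R"
    using \<open>bounded K\<close> by (auto simp: bounded_iff)
  have R0: "0 \<le> R" using \<open>K \<noteq> {}\<close> R norm_ge_zero order_trans by blast
  \<comment> \<open>Each summand bounds \<open>g i\<close> on \<open>K\<close>, so \<open>M\<close>
    minus the sum of the \<open>g i\<close> is nonnegative there; the leading \<open>1\<close> makes
    \<open>M\<close> positive, so that one can divide by it.\<close>
  define M where "M = 1 + (\<Sum>i<s. \<bar>b i\<bar> + norm (a i) * R)"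
  have "0 < M" unfolding M_def using R0 by (intro add_pos_nonneg sum_nonneg) auto
  have "\<exists>d c. 0 \<le> d \<and> (\<forall>i. 0 \<le> c i) \<and> M - (\<Sum>i<s. b i) = d + (\<Sum>i<s. c i * b i)
      \<and> - (\<Sum>i<s. a i) = (\<Sum>i<s. c i *\<^sub>R a i)"
  proof -
    have "0 \<le> (M - (\<Sum>i<s. b i)) + - (\<Sum>i<s. a i) \<bullet> x" if "x \<in> K" for x
    proof -
      have "b i + a i \<bullet> x \<le> \<bar>b i\<bar> + norm (a i) * R" for i
      proof -
        have "a i \<bullet> x \<le> norm (a i) * norm x" by (rule norm_cauchy_schwarz)
        also have "\<dots> \<le> norm (a i) * R" using R[OF that] by (intro mult_left_mono) auto
        finally show ?thesis by linarith
      qed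
      then have "(\<Sum>i<s. b i + a i \<bullet> x) \<le> (\<Sum>i<s. \<bar>b i\<bar> + norm (a i) * R)" by (intro sum_mono)
      then show ?thesis by (simp add: M_def sum.distrib inner_sum_left)
    qed
    from affine_farkas[OF K_eq \<open>K \<noteq> {}\<close> this] show ?thesis by metis
  qed
  then obtain d c where dc: "0 \<le> d" "\<And>i. 0 \<le> c i" "M - (\<Sum>i<s. b i) = d + (\<Sum>i<s. c i * b i)"
    "- (\<Sum>i<s. a i) = (\<Sum>i<s. c i *\<^sub>R a i)" by blast
  have "\<exists>d c. R = d + (\<Sum>i<s. c i * b i) \<and> axis j 1 = (\<Sum>i<s. c i *\<^sub>R a i)" for j
  proof -
    have "0 \<le> R + axis j 1 \<bullet> x" if "x \<in> K" for x
      using R[OF that] component_le_norm_cart[of x j] by (simp add: inner_axis')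
    from affine_farkas[OF K_eq \<open>K \<noteq> {}\<close> this] show ?thesis by metis
  qed
  then obtain d' c' where dc': "\<And>j. R = d' j + (\<Sum>i<s. c' j i * b i)"
    "\<And>j. axis j 1 = (\<Sum>i<s. c' j i *\<^sub>R a i)" by metis
  \<comment> \<open>Index \<open>s\<close> carries the extra affine polynomial, \<open>M\<close>
    minus the sum of the \<open>g i\<close>; division by \<open>M\<close> makes the
    \<open>s + 1\<close> polynomials sum to \<open>1\<close>.\<close>
  define bt where "bt i = (if i < s then b i else M - (\<Sum>i<s. b i)) / M" for i
  define at' where "at' i = (if i < s then a i else - (\<Sum>i<s. a i)) /\<^sub>R M" for i
  define t where "t i = affine_poly (bt i) (at' i)" for i
  \<comment> \<open>The constant \<open>d' j - R\<close> is spread over all letters because the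
    \<open>t i\<close> sum to \<open>1\<close>; the factor \<open>M\<close> undoes the scaling, as
    \<open>g i\<close> is \<open>M\<close> times \<open>t i\<close> for
    \<open>i < s\<close>.\<close>
  define y :: "nat \<Rightarrow> real^'n" where
    "y i = (\<chi> j. (d' j - R) + (if i < s then M * c' j i else 0))" for i
  have split: "(\<Sum>i\<le>s. F i) = (\<Sum>i<s. F i) + F s" for F :: "nat \<Rightarrow> 'z::comm_monoid_add"
    by (simp flip: lessThan_Suc_atMost)
  have sum_t: "sum t {..s} = 1"
  proof -
    have "sum bt {..s} = 1"
      using \<open>0 < M\<close> by (simp add: split bt_def field_simps flip: sum_divide_distrib)
    moreover have "sum at' {..s} = 0"
      by (simp add: split at'_def flip: scaleR_sum_right)
    ultimately show ?thesis
      unfolding t_def affine_poly_sum by (simp add: affine_poly_const)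
  qed
  have cone: "\<exists>d c. 0 \<le> d \<and> (\<forall>k. 0 \<le> c k) \<and>
      t i = Poly_Mapping.single 0 d + (\<Sum>k<s. Poly_Mapping.single 0 (c k) * g k)" if "i \<le> s" for i
  proof (cases "i < s")
    case True
    have "(\<Sum>k<s. Poly_Mapping.single 0 (if k = i then 1 / M else 0) * g k)
        = (\<Sum>k<s. if k = i then Poly_Mapping.single 0 (1 / M) * g i else 0)"
      by (intro sum.cong) auto
    also have "\<dots> = Poly_Mapping.single 0 (1 / M) * g i" using True by simp
    also have "\<dots> = t i"
      using True by (simp add: g const_mult_affine_poly t_def bt_def at'_def divide_inverse mult.commute)
    finally show ?thesis
      using \<open>0 < M\<close> by (intro exI[of _ 0] exI[of _ "\<lambda>k. if k = i then 1 / M else 0"]) auto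
  next
    case False
    then have "i = s" using that by simp
    have "Poly_Mapping.single 0 (c k / M) * g k = affine_poly (c k * b k / M) (c k *\<^sub>R a k /\<^sub>R M)"
      if "k < s" for k
      unfolding g[OF that] const_mult_affine_poly by (simp add: divide_inverse mult_ac)
    then have "Poly_Mapping.single 0 (d / M) + (\<Sum>k<s. Poly_Mapping.single 0 (c k / M) * g k)
      = affine_poly (d / M) 0 + (\<Sum>k<s. affine_poly (c k * b k / M) (c k *\<^sub>R a k /\<^sub>R M))"
      by (simp add: affine_poly_const)
    also have "\<dots> = affine_poly ((d + (\<Sum>i<s. c i * b i)) / M) ((\<Sum>i<s. c i *\<^sub>R a i) /\<^sub>R M)"
      by (simp only: affine_poly_sum affine_poly_add sum_divide_distrib add_divide_distrib
          scaleR_sum_right add_0)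
    also have "\<dots> = t i"
      by (simp add: t_def bt_def at'_def \<open>i = s\<close> dc)
    finally show ?thesis
      using \<open>0 < M\<close> dc(1,2) by (intro exI[of _ "d / M"] exI[of _ "\<lambda>k. c k / M"]) auto
  qed
  have "barycentric_functional (linearization v) (Poly_Mapping.single 0) {..s} t"
  proof
    show "linearization v 1 = 1"
      using linearization_single[of v 0 1] by (simp add: v0)
    show "0 \<le> linearization v (\<Prod>m<N. t (w m))" if "w \<in> {..<N} \<rightarrow>\<^sub>E {..s}" for N :: nat and w
    proof -
      have "0 \<le> linearization v ((\<Prod>m<N. t (w m)) * power_product s g (\<lambda>_. 0))"
        using that cone by (intro linearization_prod_cone_nonneg v) (auto simp: PiE_def Pi_def)
      then show ?thesis by (simp add: power_product_def)
    qed
  qed (simp_all add: linearization_add linearization_const_mult mult_single sum_t)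
  then show ?thesis
  proof (rule linearization_nonneg_barycentric)
    show "t i = affine_poly (bt i) (at' i)" for i by (simp add: t_def)
    show "0 < (\<Sum>\<alpha>\<in>B. f \<alpha> * monomial_at \<alpha> x)" if "\<And>i. i \<in> {..s} \<Longrightarrow> 0 \<le> bt i + at' i \<bullet> x" for x
    proof (rule pos)
      have "0 \<le> b i + a i \<bullet> x" if "i < s" for i
      proof -
        have "bt i + at' i \<bullet> x = (b i + a i \<bullet> x) / M"
          using that by (simp add: bt_def at'_def divide_inverse distrib_left mult.commute)
        with \<open>\<And>i. i \<in> {..s} \<Longrightarrow> 0 \<le> bt i + at' i \<bullet> x\<close>[of i] that \<open>0 < M\<close> show ?thesis
          by (simp add: zero_le_divide_iff)
      qed
      then show "x \<in> K" by (simp add: K_eq)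
    qed
    show "poly_var j = (\<Sum>i\<le>s. Poly_Mapping.single 0 (y i $ j) * t i)" for j
    proof -
      have "(\<Sum>i\<le>s. Poly_Mapping.single 0 (y i $ j) * t i)
        = Poly_Mapping.single 0 (d' j - R) * sum t {..s}
          + (\<Sum>i<s. Poly_Mapping.single 0 (M * c' j i) * t i)"
        by (simp add: y_def single_add distrib_right distrib_left sum.distrib sum_distrib_left split)
      also have "(\<Sum>i<s. Poly_Mapping.single 0 (M * c' j i) * t i)
          = (\<Sum>i<s. affine_poly (c' j i * b i) (c' j i *\<^sub>R a i))"
        using \<open>0 < M\<close>
        by (intro sum.cong) (simp_all add: t_def bt_def at'_def const_mult_affine_poly field_simps)
      also have "Poly_Mapping.single 0 (d' j - R) * sum t {..s} = affine_poly (d' j - R) 0"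
        by (simp add: sum_t affine_poly_const)
      also have "affine_poly (d' j - R) 0 + (\<Sum>i<s. affine_poly (c' j i * b i) (c' j i *\<^sub>R a i))
          = affine_poly (d' j - R + (\<Sum>i<s. c' j i * b i)) (\<Sum>i<s. c' j i *\<^sub>R a i)"
        by (simp add: affine_poly_sum affine_poly_add)
      also have "\<dots> = poly_var j"
        using dc'(1)[of j] by (simp add: affine_poly_axis flip: dc'(2))
      finally show ?thesis by simp
    qed
  qed
qed

section \<open>Nearest points of convex hulls\<close>

text \<open>Gaussian elimination: an equation with nonzero coefficient at some \<open>x0\<close>
  eliminates that unknown, leaving a system with one equation and one unknown fewer.\<close>

lemma homogeneous_system_nontrivial:
  fixes m :: "'b \<Rightarrow> 'x \<Rightarrow> real"
  assumes "finite B" "finite T" "card B < card T"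
  shows "\<exists>w. (\<exists>x\<in>T. w x \<noteq> 0) \<and> (\<forall>b\<in>B. (\<Sum>x\<in>T. w x * m b x) = 0)"
  using assms
proof (induction B arbitrary: T m rule: finite_induct)
  case empty
  then show ?case by (intro exI[of _ "\<lambda>_. 1"]) (auto simp: card_gt_0_iff)
next
  case (insert b0 B)
  show ?case
  proof (cases "\<forall>x\<in>T. m b0 x = 0")
    case True
    have "card B < card T" using insert by simp
    from insert.IH[OF insert.prems(1) this, of m] True show ?thesis by auto
  next
    case False
    then obtain x0 where x0: "x0 \<in> T" "m b0 x0 \<noteq> 0" by blast
    define m' where "m' b x = m b x - m b x0 * m b0 x / m b0 x0" for b x
    have "card B < card (T - {x0})" using insert x0 by simp
    from insert.IH[OF _ this, of m'] insert.prems(1)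
    obtain w where w: "\<exists>x\<in>T - {x0}. w x \<noteq> 0" "\<forall>b\<in>B. (\<Sum>x\<in>T - {x0}. w x * m' b x) = 0"
      by auto
    define r where "r = (\<Sum>x\<in>T - {x0}. w x * m b0 x)"
    \<comment> \<open>The value at \<open>x0\<close> is the one forced by equation
      \<open>b0\<close>.\<close>
    define w' where "w' = w(x0 := - r / m b0 x0)"
    have split: "(\<Sum>x\<in>T. w' x * m b x) = - r / m b0 x0 * m b x0 + (\<Sum>x\<in>T - {x0}. w x * m b x)" for b
      using x0 insert.prems(1)
      by (subst sum.remove[of T x0]) (auto simp: w'_def intro!: sum.cong)
    have "(\<Sum>x\<in>T. w' x * m b x) = 0" if "b \<in> B" for b
    proof -
      have "0 = (\<Sum>x\<in>T - {x0}. w x * m' b x)" using w(2) that by simp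
      also have "\<dots> = (\<Sum>x\<in>T - {x0}. w x * m b x) - (\<Sum>x\<in>T - {x0}. (m b x0 / m b0 x0) * (w x * m b0 x))"
        by (simp add: m'_def algebra_simps sum_subtractf)
      also have "\<dots> = (\<Sum>x\<in>T - {x0}. w x * m b x) - (m b x0 / m b0 x0) * r"
        by (simp only: r_def sum_distrib_left)
      finally show ?thesis by (simp add: split)
    qed
    moreover have "(\<Sum>x\<in>T. w' x * m b0 x) = 0"
      unfolding split using x0 by (simp add: r_def)
    moreover have "\<exists>x\<in>T. w' x \<noteq> 0" using w(1) by (auto simp: w'_def)
    ultimately show ?thesis by blast
  qed
qed

text \<open>While there are more than \<open>card A + 1\<close> atoms, some nonzero \<open>w\<close>
  of total \<open>0\<close> changes no coordinate in \<open>A\<close>; moving along it until a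
  weight vanishes removes an atom.\<close>

lemma caratheodory_coordinates:
  fixes m :: "'b \<Rightarrow> 'x \<Rightarrow> real"
  assumes "finite A" "finite T" "\<And>x. x \<in> T \<Longrightarrow> 0 \<le> u x" "sum u T = 1"
  shows "\<exists>T' u'. T' \<subseteq> T \<and> card T' \<le> Suc (card A) \<and> (\<forall>x\<in>T'. 0 \<le> u' x) \<and> sum u' T' = 1 \<and>
    (\<forall>\<alpha>\<in>A. (\<Sum>x\<in>T'. u' x * m \<alpha> x) = (\<Sum>x\<in>T. u x * m \<alpha> x))"
  using assms(2-)
proof (induction "card T" arbitrary: T u rule: less_induct)
  case less
  show ?case
  proof (cases "card T \<le> Suc (card A)")
    case True
    then show ?thesis using less.prems by blast
  next
    case False
    \<comment> \<open>The row \<open>None\<close> records the total weight, so one system expresses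
      conservation of mass and of the coordinates.\<close>
    define m' where "m' c x = (case c of None \<Rightarrow> 1 | Some \<alpha> \<Rightarrow> m \<alpha> x)" for c x
    have "card (insert None (Some ` A)) < card T"
      using False \<open>finite A\<close> by (simp add: card_image)
    from homogeneous_system_nontrivial[OF _ less.prems(1) this, of m'] \<open>finite A\<close>
    obtain w where w: "\<exists>x\<in>T. w x \<noteq> 0" "\<forall>c\<in>insert None (Some ` A). (\<Sum>x\<in>T. w x * m' c x) = 0"
      by auto
    have w0: "(\<Sum>x\<in>T. w x) = 0" using w(2)[rule_format, of None] by (simp add: m'_def)
    have wA: "(\<Sum>x\<in>T. w x * m \<alpha> x) = 0" if "\<alpha> \<in> A" for \<alpha>
      using w(2)[rule_format, of "Some \<alpha>"] that by (simp add: m'_def)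
    define P where "P = {x \<in> T. 0 < w x}"
    have "P \<noteq> {}"
    proof
      assume "P = {}"
      then have "\<forall>x\<in>T. w x \<le> 0" by (auto simp: P_def not_less)
      then have "\<forall>x\<in>T. w x = 0"
        using w0 less.prems(1) sum_nonneg_eq_0_iff[of T "\<lambda>x. - w x"] by (simp add: sum_negf)
      then show False using w(1) by blast
    qed
    have "finite P" using less.prems(1) by (simp add: P_def)
    \<comment> \<open>The longest step that keeps all weights nonnegative; the weight of the
      minimiser \<open>z\<close> becomes \<open>0\<close>.\<close>
    define \<theta> where "\<theta> = Min ((\<lambda>x. u x / w x) ` P)"
    have "\<theta> \<in> (\<lambda>x. u x / w x) ` P"
      unfolding \<theta>_def using \<open>finite P\<close> \<open>P \<noteq> {}\<close> by (intro Min_in) auto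
    then obtain z where z: "z \<in> P" "\<theta> = u z / w z" by blast
    have \<theta>_le: "\<theta> \<le> u x / w x" if "x \<in> P" for x
      unfolding \<theta>_def using \<open>finite P\<close> that by (intro Min_le) auto
    have "0 \<le> \<theta>" using z less.prems(2) by (auto simp: P_def)
    define u' where "u' x = u x - \<theta> * w x" for x
    have u'z: "u' z = 0" using z by (auto simp: u'_def P_def)
    have "z \<in> T" using z by (simp add: P_def)
    have drop: "(\<Sum>x\<in>T - {z}. u' x * h x) = (\<Sum>x\<in>T. u x * h x) - \<theta> * (\<Sum>x\<in>T. w x * h x)" for h
    proof -
      have "(\<Sum>x\<in>T - {z}. u' x * h x) = (\<Sum>x\<in>T. u' x * h x)"
        using less.prems(1) \<open>z \<in> T\<close> by (simp add: sum.remove u'z)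
      then show ?thesis by (simp add: u'_def algebra_simps sum_subtractf sum_distrib_left)
    qed
    have nonneg: "0 \<le> u' x" if "x \<in> T - {z}" for x
    proof (cases "x \<in> P")
      case True
      then show ?thesis using \<theta>_le[OF True] by (simp add: u'_def P_def field_simps)
    next
      case False
      then have "\<theta> * w x \<le> 0" using that \<open>0 \<le> \<theta>\<close>
        by (intro mult_nonneg_nonpos) (auto simp: P_def)
      then show ?thesis using less.prems(2)[of x] that by (simp add: u'_def)
    qed
    have one: "sum u' (T - {z}) = 1"
      using drop[of "\<lambda>_. 1"] w0 less.prems(3) by simp
    have "card (T - {z}) < card T" using less.prems(1) \<open>z \<in> T\<close> by (rule card_Diff1_less)
    from less.hyps[OF this _ nonneg one] less.prems(1)
    obtain T' u'' where T': "T' \<subseteq> T - {z}" "card T' \<le> Suc (card A)" "\<forall>x\<in>T'. 0 \<le> u'' x"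
      "sum u'' T' = 1" "\<forall>\<alpha>\<in>A. (\<Sum>x\<in>T'. u'' x * m \<alpha> x) = (\<Sum>x\<in>T - {z}. u' x * m \<alpha> x)"
      by auto
    then show ?thesis using drop wA by (intro exI[of _ T'] exI[of _ u'']) auto
  qed
qed

lemma lookup_scaleR: "Poly_Mapping.lookup (c *\<^sub>R f) k = c * Poly_Mapping.lookup (f :: _ \<Rightarrow>\<^sub>0 real) k"
  by (simp add: scaleR_poly_mapping_def Poly_Mapping.map.rep_eq when_def)

text \<open>The ambient space \<open>'a \<Rightarrow>\<^sub>0 real\<close> is infinite-dimensional; by Caratheodory only
  \<open>card A + 1\<close> atoms matter for the coordinates in \<open>A\<close>, so the minimisation runs over a compact
  set of weights and atoms.\<close>

lemma convex_hull_nearest_point: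
  fixes e :: "'x::topological_space \<Rightarrow> ('a \<Rightarrow>\<^sub>0 real)" and v :: "'a \<Rightarrow> real"
  assumes K: "compact K" "K \<noteq> {}" and A: "finite A"
    and cont: "\<And>\<alpha>. \<alpha> \<in> A \<Longrightarrow> continuous_on K (\<lambda>x. Poly_Mapping.lookup (e x) \<alpha>)"
  shows "\<exists>p\<in>convex hull (e ` K). \<forall>q\<in>convex hull (e ` K).
    (\<Sum>\<alpha>\<in>A. (v \<alpha> - Poly_Mapping.lookup p \<alpha>)\<^sup>2) \<le> (\<Sum>\<alpha>\<in>A. (v \<alpha> - Poly_Mapping.lookup q \<alpha>)\<^sup>2)"
proof -
  define n where "n = Suc (card A)"
  define D where "D q = (\<Sum>\<alpha>\<in>A. (v \<alpha> - Poly_Mapping.lookup q \<alpha>)\<^sup>2)" for q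
  \<comment> \<open>Sequences over all of \<open>nat\<close> form a product space, compact by
    Tychonoff's theorem; only the first \<open>n\<close> entries enter the sums in \<open>C\<close>
    and \<open>\<Phi>\<close>.\<close>
  define X where "X = (UNIV :: nat set) \<rightarrow>\<^sub>E ({0..1::real} \<times> K)"
  define C where "C = {c \<in> X. (\<Sum>i<n. fst (c i)) = 1}"
  define \<Phi> where "\<Phi> c = (\<Sum>i<n. fst (c i) *\<^sub>R e (snd (c i)))" for c :: "nat \<Rightarrow> real \<times> 'x"
  obtain x0 where "x0 \<in> K" using K by blast
  have "compact X"
  proof -
    have "compactin (product_topology (\<lambda>_::nat. euclidean) UNIV) (UNIV \<rightarrow>\<^sub>E ({0..1::real} \<times> K))"
      using K by (simp add: compactin_PiE compact_Times)
    then show ?thesis by (simp add: X_def euclidean_product_topology)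
  qed
  have coord: "continuous_on S (\<lambda>c :: nat \<Rightarrow> real \<times> 'x. c i)" for S i
    by (rule continuous_on_product_coordinates[THEN continuous_on_subset]) simp
  have "closed {c :: nat \<Rightarrow> real \<times> 'x. (\<Sum>i<n. fst (c i)) = 1}"
    by (intro closed_Collect_eq continuous_intros coord)
  from compact_Int_closed[OF \<open>compact X\<close> this] have "compact C"
    by (simp add: C_def Collect_conj_eq)
  have \<Phi>_hull: "\<Phi> c \<in> convex hull (e ` K)" if "c \<in> C" for c
    unfolding \<Phi>_def using that
    by (intro convex_sum convex_convex_hull) (auto simp: C_def X_def PiE_def Pi_def mem_Times_iff intro: hull_inc)
  have D_\<Phi>: "D (\<Phi> c) = (\<Sum>\<alpha>\<in>A. (v \<alpha> - (\<Sum>i<n. fst (c i) * Poly_Mapping.lookup (e (snd (c i))) \<alpha>))\<^sup>2)" for c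
    by (simp add: D_def \<Phi>_def lookup_sum lookup_scaleR)
  have "continuous_on C (\<lambda>c. D (\<Phi> c))"
    unfolding D_\<Phi>
    by (intro continuous_intros coord continuous_on_compose2[OF cont])
      (auto simp: C_def X_def PiE_def Pi_def mem_Times_iff)
  \<comment> \<open>\<open>\<Phi> c\<close> is made to match \<open>q\<close> in the coordinates in
    \<open>A\<close>, which are all that \<open>D\<close> sees.\<close>
  have cover: "\<exists>c\<in>C. D (\<Phi> c) = D q" if "q \<in> convex hull (e ` K)" for q
  proof -
    from that obtain T u where T: "finite T" "T \<subseteq> e ` K" "\<forall>x\<in>T. 0 \<le> u x" "sum u T = 1"
      and q: "(\<Sum>x\<in>T. u x *\<^sub>R x) = q"
      unfolding convex_hull_explicit by auto
    obtain T' u' where T': "T' \<subseteq> T" "card T' \<le> n" "\<forall>x\<in>T'. 0 \<le> u' x" "sum u' T' = 1"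
      and eq: "\<forall>\<alpha>\<in>A. (\<Sum>x\<in>T'. u' x * Poly_Mapping.lookup x \<alpha>) = (\<Sum>x\<in>T. u x * Poly_Mapping.lookup x \<alpha>)"
      using caratheodory_coordinates[OF A T(1), of u "\<lambda>\<alpha> x. Poly_Mapping.lookup x \<alpha>"] T
      unfolding n_def by auto
    have finT': "finite T'" using T' T finite_subset by blast
    obtain h where h: "bij_betw h {0..<card T'} T'" using ex_bij_betw_nat_finite[OF finT'] by blast
    have h_in: "h i \<in> T'" if "i < card T'" for i using h that by (auto simp: bij_betw_def)
    have "\<forall>x\<in>T'. \<exists>y\<in>K. e y = x" using T T' by blast
    then obtain k where k: "\<And>x. x \<in> T' \<Longrightarrow> k x \<in> K" "\<And>x. x \<in> T' \<Longrightarrow> e (k x) = x" by metis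
    \<comment> \<open>The remaining slots are padded with weight \<open>0\<close> at
      \<open>x0\<close>.\<close>
    define c where "c i = (if i < card T' then (u' (h i), k (h i)) else (0, x0))" for i
    have sum_c: "(\<Sum>i<n. fst (c i) * F (snd (c i))) = (\<Sum>x\<in>T'. u' x * F (k x))" for F :: "'x \<Rightarrow> real"
    proof -
      have "(\<Sum>i<n. fst (c i) * F (snd (c i))) = (\<Sum>i\<in>{0..<card T'}. fst (c i) * F (snd (c i)))"
        using T'(2) by (intro sum.mono_neutral_right) (auto simp: c_def)
      also have "\<dots> = (\<Sum>i\<in>{0..<card T'}. u' (h i) * F (k (h i)))"
        by (intro sum.cong) (auto simp: c_def)
      also have "\<dots> = (\<Sum>x\<in>T'. u' x * F (k x))"
        by (rule sum.reindex_bij_betw[OF h])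
      finally show ?thesis .
    qed
    have "u' x \<le> 1" if "x \<in> T'" for x
      using member_le_sum[OF that, of u'] T' finT' by auto
    then have "c \<in> X" unfolding X_def using T' k h_in \<open>x0 \<in> K\<close> by (auto simp: c_def)
    moreover have "(\<Sum>i<n. fst (c i)) = 1" using sum_c[of "\<lambda>_. 1"] T' by simp
    ultimately have "c \<in> C" by (simp add: C_def)
    moreover have "D (\<Phi> c) = D q"
    proof -
      have "(\<Sum>x\<in>T'. u' x * Poly_Mapping.lookup (e (k x)) \<alpha>) = Poly_Mapping.lookup q \<alpha>" if "\<alpha> \<in> A" for \<alpha>
      proof -
        have "(\<Sum>x\<in>T'. u' x * Poly_Mapping.lookup (e (k x)) \<alpha>) = (\<Sum>x\<in>T'. u' x * Poly_Mapping.lookup x \<alpha>)"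
          by (intro sum.cong) (auto simp: k)
        also have "\<dots> = Poly_Mapping.lookup q \<alpha>"
          using eq that by (simp add: lookup_sum lookup_scaleR flip: q)
        finally show ?thesis .
      qed
      then show ?thesis
        unfolding D_\<Phi> sum_c[of "\<lambda>y. Poly_Mapping.lookup (e y) _"] by (simp add: D_def)
    qed
    ultimately show ?thesis by blast
  qed
  have "C \<noteq> {}" using cover[of "e x0"] \<open>x0 \<in> K\<close> by (auto intro: hull_inc)
  from continuous_attains_inf[OF \<open>compact C\<close> this \<open>continuous_on C (\<lambda>c. D (\<Phi> c))\<close>]
  obtain c where c: "c \<in> C" "\<forall>c'\<in>C. D (\<Phi> c) \<le> D (\<Phi> c')" by blast
  show ?thesis
  proof (intro bexI ballI)
    show "\<Phi> c \<in> convex hull (e ` K)" by (rule \<Phi>_hull[OF c(1)])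
    fix q assume "q \<in> convex hull (e ` K)"
    then obtain c' where "c' \<in> C" "D (\<Phi> c') = D q" using cover by blast
    then have "D (\<Phi> c) \<le> D q" using c(2) by metis
    then show "(\<Sum>\<alpha>\<in>A. (v \<alpha> - Poly_Mapping.lookup (\<Phi> c) \<alpha>)\<^sup>2) \<le> (\<Sum>\<alpha>\<in>A. (v \<alpha> - Poly_Mapping.lookup q \<alpha>)\<^sup>2)"
      by (simp only: D_def)
  qed
qed

section \<open>Separation at the nearest point and the two inclusions\<close>

lemma coord_proj_combination:
  "coord_proj A (\<lambda>\<alpha>. u * v \<alpha> + w * v' \<alpha>) = u *\<^sub>R coord_proj A v + w *\<^sub>R coord_proj A v'"
proof -
  have "Poly_Mapping.single \<alpha> (u * v \<alpha> + w * v' \<alpha>)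
      = u *\<^sub>R Poly_Mapping.single \<alpha> (v \<alpha>) + w *\<^sub>R Poly_Mapping.single \<alpha> (v' \<alpha>)" for \<alpha>
    by (rule poly_mapping_eqI) (simp add: lookup_add lookup_scaleR lookup_single when_def)
  then show ?thesis by (simp add: coord_proj_def sum.distrib scaleR_sum_right)
qed

lemma linearization_combination:
  "linearization (\<lambda>\<alpha>. u * v \<alpha> + w * v' \<alpha>) f = u * linearization v f + w * linearization v' f"
  by (simp add: linearization_def distrib_left sum.distrib sum_distrib_left mult.left_commute)

text \<open>First-order optimality at a nearest point, with \<open>\<delta>\<close> the residual and
  \<open>d\<close> a feasible direction: on expanding the square, the term linear in
  \<open>\<theta>\<close> dominates for small \<open>\<theta>\<close>.\<close>

lemma variational_inequality:
  fixes \<delta> d :: "'a \<Rightarrow> real"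
  assumes "\<And>\<theta>. 0 < \<theta> \<Longrightarrow> \<theta> \<le> 1 \<Longrightarrow> (\<Sum>\<alpha>\<in>A. (\<delta> \<alpha>)\<^sup>2) \<le> (\<Sum>\<alpha>\<in>A. (\<delta> \<alpha> - \<theta> * d \<alpha>)\<^sup>2)"
  shows "(\<Sum>\<alpha>\<in>A. \<delta> \<alpha> * d \<alpha>) \<le> 0"
proof (rule ccontr)
  define S where "S = (\<Sum>\<alpha>\<in>A. \<delta> \<alpha> * d \<alpha>)"
  define N where "N = (\<Sum>\<alpha>\<in>A. (d \<alpha>)\<^sup>2)"
  assume "\<not> (\<Sum>\<alpha>\<in>A. \<delta> \<alpha> * d \<alpha>) \<le> 0"
  then have "0 < S" by (simp add: S_def)
  have "0 \<le> N" by (simp add: N_def sum_nonneg)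
  \<comment> \<open>Small enough that \<open>\<theta> * N \<le> S < 2 * S\<close>; the summand
    \<open>1\<close> covers \<open>N = 0\<close>.\<close>
  define \<theta> where "\<theta> = min 1 (S / (N + 1))"
  have \<theta>: "0 < \<theta>" "\<theta> \<le> 1" "\<theta> \<le> S / (N + 1)" using \<open>0 < S\<close> \<open>0 \<le> N\<close> by (auto simp: \<theta>_def)
  have "(\<Sum>\<alpha>\<in>A. (\<delta> \<alpha> - \<theta> * d \<alpha>)\<^sup>2) = (\<Sum>\<alpha>\<in>A. (\<delta> \<alpha>)\<^sup>2) - 2 * \<theta> * S + \<theta>\<^sup>2 * N"
    by (simp add: S_def N_def power2_diff sum.distrib sum_subtractf sum_distrib_left power_mult_distrib
        algebra_simps)
  with assms[OF \<theta>(1,2)] have "2 * \<theta> * S \<le> \<theta>\<^sup>2 * N" by simp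
  then have "2 * S \<le> \<theta> * N" using \<theta>(1) by (simp add: power2_eq_square)
  also have "\<dots> \<le> S / (N + 1) * N" using \<theta>(3) \<open>0 \<le> N\<close> by (rule mult_right_mono)
  also have "\<dots> \<le> S" using \<open>0 < S\<close> \<open>0 \<le> N\<close> by (simp add: field_simps)
  finally show False using \<open>0 < S\<close> by simp
qed

theorem theorem2p11:
  fixes K :: "(real^'n) set"
    and s :: nat
    and g :: "nat \<Rightarrow> 'n mpoly"
    and A :: "('n \<Rightarrow>\<^sub>0 nat) set"
  assumes "K \<noteq> {}"
    and "polyhedron K" and "bounded K"
    and "K = {x. \<forall>i<s. mpoly_at (g i) x \<ge> 0}"
    and "\<And>i. i < s \<Longrightarrow> total_degree (g i) = 1"
    and "finite A" and "0 \<notin> A"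
  shows "moment_body A K =
    coord_proj A ` {v. v 0 = 1 \<and> (\<forall>\<beta>. linearization v (power_product s g \<beta>) \<ge> 0)}"
proof
  define V where "V = {v. v 0 = 1 \<and> (\<forall>\<beta>. linearization v (power_product s g \<beta>) \<ge> 0)}"
  define e where "e x = coord_proj A (\<lambda>\<alpha>. monomial_at \<alpha> x)" for x :: "real^'n"
  have body: "moment_body A K = convex hull (e ` K)"
    by (simp add: moment_body_def e_def[abs_def])
  \<comment> \<open>First inclusion: a convex set containing all point evaluations contains their
    hull.\<close>
  have "convex (coord_proj A ` V)"
  proof (rule convexI)
    fix p q and u w :: real
    assume "p \<in> coord_proj A ` V" "q \<in> coord_proj A ` V" and uw: "0 \<le> u" "0 \<le> w" "u + w = 1"
    then obtain v v' where v: "v \<in> V" "v' \<in> V" "p = coord_proj A v" "q = coord_proj A v'" by blast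
    then have "(\<lambda>\<alpha>. u * v \<alpha> + w * v' \<alpha>) \<in> V"
      using uw by (simp add: V_def linearization_combination)
    then show "u *\<^sub>R p + w *\<^sub>R q \<in> coord_proj A ` V"
      unfolding v(3,4) coord_proj_combination[symmetric] by (rule imageI)
  qed
  moreover have "e ` K \<subseteq> coord_proj A ` V"
  proof
    fix q assume "q \<in> e ` K"
    then obtain x where x: "x \<in> K" "q = e x" by blast
    have "0 \<le> linearization (\<lambda>\<alpha>. monomial_at \<alpha> x) (power_product s g \<beta>)" for \<beta>
      using x(1) assms(4)
      by (auto simp: power_product_def mpoly_at_prod mpoly_at_power
          simp flip: mpoly_at_eq_linearization intro!: prod_nonneg zero_le_power)
    then have "(\<lambda>\<alpha>. monomial_at \<alpha> x) \<in> V" by (simp add: V_def)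
    then show "q \<in> coord_proj A ` V" by (auto simp: x(2) e_def)
  qed
  ultimately show "moment_body A K \<subseteq> coord_proj A ` V"
    unfolding body by (rule hull_minimal[rotated])
  show "coord_proj A ` V \<subseteq> moment_body A K"
  proof clarify
    fix v assume "v \<in> V"
    have e_lookup: "Poly_Mapping.lookup (e x) \<alpha> = (if \<alpha> \<in> A then monomial_at \<alpha> x else 0)" for x \<alpha>
      by (simp add: e_def lookup_coord_proj \<open>finite A\<close>)
    have "compact K"
      using assms(2,3) by (simp add: compact_eq_bounded_closed polyhedron_imp_closed)
    moreover have "continuous_on K (\<lambda>x. Poly_Mapping.lookup (e x) \<alpha>)" if "\<alpha> \<in> A" for \<alpha>
      using that by (simp add: e_lookup continuous_on_monomial_at)
    ultimately obtain p where p: "p \<in> convex hull (e ` K)"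
      and near: "\<And>q. q \<in> convex hull (e ` K) \<Longrightarrow>
        (\<Sum>\<alpha>\<in>A. (v \<alpha> - Poly_Mapping.lookup p \<alpha>)\<^sup>2) \<le> (\<Sum>\<alpha>\<in>A. (v \<alpha> - Poly_Mapping.lookup q \<alpha>)\<^sup>2)"
      using convex_hull_nearest_point[OF _ \<open>K \<noteq> {}\<close> \<open>finite A\<close>, of e v] by blast
    define \<delta> where "\<delta> \<alpha> = v \<alpha> - Poly_Mapping.lookup p \<alpha>" for \<alpha>
    \<comment> \<open>The residual makes no acute angle with the segment from \<open>p\<close> to
      any \<open>e x\<close>.\<close>
    have le: "(\<Sum>\<alpha>\<in>A. \<delta> \<alpha> * (monomial_at \<alpha> x - Poly_Mapping.lookup p \<alpha>)) \<le> 0" if "x \<in> K" for x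
    proof (rule variational_inequality)
      fix \<theta> :: real assume "0 < \<theta>" "\<theta> \<le> 1"
      define q where "q = (1 - \<theta>) *\<^sub>R p + \<theta> *\<^sub>R e x"
      have "q \<in> convex hull (e ` K)"
        unfolding q_def using p that \<open>0 < \<theta>\<close> \<open>\<theta> \<le> 1\<close>
        by (intro convexD[OF convex_convex_hull]) (auto intro: hull_inc)
      moreover have "v \<alpha> - Poly_Mapping.lookup q \<alpha>
          = \<delta> \<alpha> - \<theta> * (monomial_at \<alpha> x - Poly_Mapping.lookup p \<alpha>)" if "\<alpha> \<in> A" for \<alpha>
        unfolding q_def \<delta>_def lookup_add lookup_scaleR e_lookup
        using that by (simp add: algebra_simps)
      then have "(\<Sum>\<alpha>\<in>A. (v \<alpha> - Poly_Mapping.lookup q \<alpha>)\<^sup>2)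
          = (\<Sum>\<alpha>\<in>A. (\<delta> \<alpha> - \<theta> * (monomial_at \<alpha> x - Poly_Mapping.lookup p \<alpha>))\<^sup>2)"
        by (intro sum.cong) auto
      ultimately show "(\<Sum>\<alpha>\<in>A. (\<delta> \<alpha>)\<^sup>2)
          \<le> (\<Sum>\<alpha>\<in>A. (\<delta> \<alpha> - \<theta> * (monomial_at \<alpha> x - Poly_Mapping.lookup p \<alpha>))\<^sup>2)"
        using near[of q] by (simp only: \<delta>_def)
    qed
    define c where "c = (\<Sum>\<alpha>\<in>A. \<delta> \<alpha> * Poly_Mapping.lookup p \<alpha>)"
    have "(\<Sum>\<alpha>\<in>A. (\<delta> \<alpha>)\<^sup>2) \<le> 0 + \<epsilon>" if "0 < \<epsilon>" for \<epsilon>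
    proof -
      \<comment> \<open>The separating polynomial: \<open>c\<close> minus the form with coefficients
        \<open>\<delta>\<close> is nonnegative on \<open>K\<close> by \<open>le\<close>, and
        \<open>\<epsilon>\<close> makes it positive. As \<open>0 \<notin> A\<close>, index
        \<open>0\<close> is free for the constant.\<close>
      define f where "f \<alpha> = (if \<alpha> = 0 then c + \<epsilon> else - \<delta> \<alpha>)" for \<alpha>
      have f_sum: "(\<Sum>\<alpha>\<in>insert 0 A. f \<alpha> * h \<alpha>) = (c + \<epsilon>) * h 0 - (\<Sum>\<alpha>\<in>A. \<delta> \<alpha> * h \<alpha>)" for h
      proof -
        have "(\<Sum>\<alpha>\<in>A. f \<alpha> * h \<alpha>) = (\<Sum>\<alpha>\<in>A. - (\<delta> \<alpha> * h \<alpha>))"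
          using \<open>0 \<notin> A\<close> by (intro sum.cong) (auto simp: f_def)
        then show ?thesis using \<open>0 \<notin> A\<close> \<open>finite A\<close> by (simp add: f_def sum_negf)
      qed
      have "0 \<le> (\<Sum>\<alpha>\<in>insert 0 A. f \<alpha> * v \<alpha>)"
      proof (rule linearization_nonneg_of_positive[OF \<open>K \<noteq> {}\<close> \<open>bounded K\<close> assms(4)])
        show "0 < (\<Sum>\<alpha>\<in>insert 0 A. f \<alpha> * monomial_at \<alpha> x)" if "x \<in> K" for x
          using le[OF that] \<open>0 < \<epsilon>\<close>
          unfolding f_sum by (simp add: c_def right_diff_distrib sum_subtractf)
      qed (use assms(5) \<open>v \<in> V\<close> in \<open>auto simp: V_def\<close>)
      moreover have "(\<Sum>\<alpha>\<in>A. (\<delta> \<alpha>)\<^sup>2) = (\<Sum>\<alpha>\<in>A. \<delta> \<alpha> * v \<alpha>) - c"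
        by (simp add: c_def \<delta>_def power2_eq_square right_diff_distrib flip: sum_subtractf)
      ultimately show ?thesis
        using \<open>v \<in> V\<close> unfolding f_sum by (simp add: V_def)
    qed
    then have "(\<Sum>\<alpha>\<in>A. (\<delta> \<alpha>)\<^sup>2) \<le> 0" by (rule field_le_epsilon)
    then have "(\<Sum>\<alpha>\<in>A. (\<delta> \<alpha>)\<^sup>2) = 0" by (meson order_antisym sum_nonneg zero_le_power2)
    then have zero: "\<delta> \<alpha> = 0" if "\<alpha> \<in> A" for \<alpha>
      using that \<open>finite A\<close> by (simp add: sum_nonneg_eq_0_iff)
    \<comment> \<open>The distance controls only coordinates in \<open>A\<close>; outside
      \<open>A\<close> every point of the hull vanishes, as \<open>coord_proj A v\<close>
      does.\<close>
    have "Poly_Mapping.lookup p \<alpha> = 0" if "\<alpha> \<notin> A" for \<alpha>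
    proof -
      have "convex {q. Poly_Mapping.lookup q \<alpha> = (0::real)}"
        by (rule convexI) (simp add: lookup_add lookup_scaleR)
      moreover have "e ` K \<subseteq> {q. Poly_Mapping.lookup q \<alpha> = 0}"
        using that by (auto simp: e_lookup)
      ultimately have "convex hull (e ` K) \<subseteq> {q. Poly_Mapping.lookup q \<alpha> = 0}"
        by (rule hull_minimal[rotated])
      then show ?thesis using p by blast
    qed
    then have "coord_proj A v = p"
      using zero by (intro poly_mapping_eqI) (auto simp: lookup_coord_proj \<open>finite A\<close> \<delta>_def)
    then show "coord_proj A v \<in> moment_body A K" using p by (simp add: body)
  qed
qed

end
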